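(* Let the $Z_i$ be i.i.d. random variables with support $[0,1]$, a density bounded and continuous on its domain, and strictly positive variance, and let all producers have the same unit investment cost $\gamma_i=\gamma>0$. Then there are constants $\alpha,c>0$, independent of $N$, such that for every $N>\dfrac{1}{\frac{D_{min}}{D_{max}}\gamma}$ and every Nash equilibrium $(C_1^\diamond,\dots,C_N^\diamond)$ of the capacity game with $N$ producers, $$\sum_{i=1}^N\pi_i(C_1^\diamond,\dots,C_N^\diamond)\le\gamma\sum_{i=1}^N C_i^\diamond+\alpha N^{-c}.$$ Therefore, as $N\to\infty$, $\xi\to1$, where $$\xi=\frac{\gamma\sum_{i=1}^N C_i^\diamond}{\sum_{i=1}^N\pi_i(C_1^\diamond,\dots,C_N^\diamond)}$$ is the market efficiency of any Nash equilibrium solution.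
   Context: Notation: $(x)^+=\max(x,0)$. The demand $D$ is a random variable with $D_{min}\le D\le D_{max}$, where $D_{min}/D_{max}$ is a constant bounded away from zero; $D$ is independent of the $Z_i$. The distributions of $D$ and of the $Z_i$, and $\gamma$, are fixed as $N$ varies. Capacity game: there are $N$ producers; producer $i$ chooses a capacity $C_i\ge 0$ and produces the random amount $C_iZ_i$. Its profit is $\pi_i(C_i,\mathbf{C}_{-i})-\gamma C_i$, where $\mathbf{C}_{-i}$ are the others' capacities and $\pi_i(\mathbf{C})$ is the expected payment to $i$ at the mixed Nash equilibrium of the price sub-game: with capacities fixed, producers bid unit prices in $[0,1]$ (customers can buy from the main grid at price $1$), consumers buy from the lowest-priced producers first until $D$ is met, and each producer is paid its own bid per unit sold. Explicitly, for $\mathbf{C}\ne 0$ let $m$ be the (largest) index of a producer of maximal capacity; then $$\pi_m(\mathbf{C})=\mathbb{E}\min\Big\{\Big(D-\sum_{j\ne m}Z_jC_j\Big)^+,Z_mC_m\Big\},\qquad \pi_i(\mathbf{C})=\pi_m(\mathbf{C})\,\frac{\mathbb{E}[\min(C_iZ_i,D)]}{\mathbb{E}[\min(C_mZ_m,D)]},$$ and $\pi_i(0)=0$. A vector $(C_1^\diamond,\dots,C_N^\diamond)$ with nonnegative entries is a Nash equilibrium if for every $i$, $C_i^\diamond$ maximizes $\pi_i(C_i,\mathbf{C}^\diamond_{-i})-\gamma C_i$ over $C_i\ge 0$. *)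

theory Defs
  imports "HOL-Probability.Probability"
begin

definition topological_support :: "'b::topological_space measure \<Rightarrow> 'b set" where
  "topological_support \<mu> = {x. \<forall>U. open U \<longrightarrow> x \<in> U \<longrightarrow> emeasure \<mu> U > 0}"

text \<open>
  The producers are \<open>0, \<dots>, N - 1\<close>. A capacity vector is a function \<open>C :: nat \<Rightarrow> real\<close>, of which
  only the values at indices below \<open>N\<close> matter. The demand is \<open>D\<close>, and producer \<open>i\<close> with
  capacity \<open>C i\<close> produces \<open>C i * Z i\<close>.

  The expected payments are those of the mixed Nash equilibrium of the pay-as-bid price
  sub-game with bids in \<open>[0, 1]\<close>, given in closed form.
\<close>

definition largest_producer :: "nat \<Rightarrow> (nat \<Rightarrow> real) \<Rightarrow> nat" where
  "largest_producer N C = Max {i. i < N \<and> (\<forall>j<N. C j \<le> C i)}"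

definition payment ::
  "'a measure \<Rightarrow> ('a \<Rightarrow> real) \<Rightarrow> (nat \<Rightarrow> 'a \<Rightarrow> real) \<Rightarrow> nat \<Rightarrow> (nat \<Rightarrow> real) \<Rightarrow> nat \<Rightarrow> real" where
  "payment M D Z N C i =
    (if \<forall>j<N. C j = 0 then 0
     else
       let m = largest_producer N C;
           \<pi>\<^sub>m = (\<integral>\<omega>. min (max (D \<omega> - (\<Sum>j\<in>{..<N} - {m}. Z j \<omega> * C j)) 0) (Z m \<omega> * C m) \<partial>M)
       in if i = m then \<pi>\<^sub>m
          else \<pi>\<^sub>m * ((\<integral>\<omega>. min (C i * Z i \<omega>) (D \<omega>) \<partial>M) / (\<integral>\<omega>. min (C m * Z m \<omega>) (D \<omega>) \<partial>M)))"

definition profit ::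
  "'a measure \<Rightarrow> ('a \<Rightarrow> real) \<Rightarrow> (nat \<Rightarrow> 'a \<Rightarrow> real) \<Rightarrow> real \<Rightarrow> nat \<Rightarrow> (nat \<Rightarrow> real) \<Rightarrow> nat \<Rightarrow> real" where
  "profit M D Z \<gamma> N C i = payment M D Z N C i - \<gamma> * C i"

definition nash_equilibrium ::
  "'a measure \<Rightarrow> ('a \<Rightarrow> real) \<Rightarrow> (nat \<Rightarrow> 'a \<Rightarrow> real) \<Rightarrow> real \<Rightarrow> nat \<Rightarrow> (nat \<Rightarrow> real) \<Rightarrow> bool" where
  "nash_equilibrium M D Z \<gamma> N C \<longleftrightarrow>
    (\<forall>i<N. 0 \<le> C i) \<and>
    (\<forall>i<N. \<forall>x\<ge>0. profit M D Z \<gamma> N (C(i := x)) i \<le> profit M D Z \<gamma> N C i)"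

definition market_efficiency ::
  "'a measure \<Rightarrow> ('a \<Rightarrow> real) \<Rightarrow> (nat \<Rightarrow> 'a \<Rightarrow> real) \<Rightarrow> real \<Rightarrow> nat \<Rightarrow> (nat \<Rightarrow> real) \<Rightarrow> real" where
  "market_efficiency M D Z \<gamma> N C = \<gamma> * (\<Sum>i<N. C i) / (\<Sum>i<N. payment M D Z N C i)"

end

theory Submission
  imports Defs
begin

text \<open>
  Write \<open>\<mu>\<close> and \<open>v\<close> for the common mean and variance of the \<open>Z i\<close>, \<open>m\<close> for the largest producer and
  \<open>sales i x\<close> for what producer \<open>i\<close> would expect to sell alone with capacity \<open>x\<close>. The payments are
  \<open>R * sales i (C i)\<close> with a common factor \<open>R \<le> 1\<close> (\<open>price_level\<close>), and \<open>sales i x \<le> \<mu> * x\<close>. So the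
  total profit is at most \<open>(\<mu> * R - \<gamma>) * (\<Sum>i<N. C i)\<close>, and it has to be shown that in equilibrium the
  total capacity is bounded while the margin \<open>\<mu> * R - \<gamma>\<close> is \<open>O(N powr - (1/6))\<close>. If \<open>\<mu> \<le> \<gamma>\<close>
  nobody ever makes a profit, so let \<open>\<gamma> < \<mu>\<close>.

  The total capacity is at least \<open>Dmin\<close>, as otherwise the largest producer would gain by filling the
  gap (\<open>nash_total_capacity_ge\<close>). It is bounded (\<open>nash_total_capacity_le\<close>), because the largest
  producer recovers its cost although it only sells when the others fail to cover the demand, and the
  probability of that decays exponentially in the total capacity.

  The margin is bounded by two different deviations, according to the size of \<open>C m\<close>.
  If \<open>C m \<ge> N powr - (2/3)\<close>, some other producer has capacity at most a constant over \<open>N\<close> and hence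
  almost no profit. Expanding to \<open>sqrt (C m / N)\<close>, it would earn the margin on that capacity, up to
  the drop of \<open>R\<close> that it causes, which is at most its capacity divided by \<open>sales m (C m)\<close>
  (\<open>margin_le_small_producer_deviation\<close>).
  If \<open>C m < N powr - (2/3)\<close>, the largest producer considers doubling its capacity. It would earn
  the margin on the additional capacity too, except when the demand left over by the others lies
  between \<open>- 2 * C m\<close> and \<open>2 * C m\<close> (\<open>margin_le_concentration\<close>). The output of the others is a sum of
  independent terms with standard deviation of order at least \<open>1 / sqrt N\<close>, none of them larger than
  \<open>C m\<close>. So the probability of that event is at most a constant times \<open>C m * sqrt N\<close>, hence
  \<open>O(N powr - (1/6))\<close>. This is where the randomness of the supply enters, through a small ball estimate
  derived from the decay of the characteristic function (\<open>concentration_le_char_decay\<close>).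

  The efficiency tends to 1 because producers never lose money in equilibrium and the total cost is
  at least \<open>\<gamma> * Dmin\<close>.
\<close>

section \<open>Support of a distribution\<close>

text \<open>
  Every point outside the support has a null open neighbourhood, and by the Lindelof property
  countably many of these cover the complement of the interval.
\<close>

lemma support_subset_interval_AE:
  fixes a b :: real
  assumes "finite_measure \<mu>" "sets \<mu> = sets borel" "topological_support \<mu> \<subseteq> {a..b}"
  shows "AE x in \<mu>. a \<le> x \<and> x \<le> b"
proof -
  define \<F> where "\<F> = {U. open U \<and> emeasure \<mu> U = 0}"
  obtain \<F>' where \<F>': "\<F>' \<subseteq> \<F>" "countable \<F>'" "\<Union>\<F>' = \<Union>\<F>"
    by (rule Lindelof[of \<F>]) (auto simp: \<F>_def)
  have "(\<Union>U\<in>\<F>'. U) \<in> null_sets \<mu>"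
    using \<F>' assms(2) by (intro null_sets_UN') (auto simp: \<F>_def null_sets_def)
  moreover have "x \<in> \<Union>\<F>" if "\<not> (a \<le> x \<and> x \<le> b)" for x
    using that assms(3) unfolding topological_support_def \<F>_def
    by (auto simp: subset_eq zero_less_iff_neq_zero)
  ultimately show ?thesis
    using \<F>'(3) by (intro AE_I'[where N = "\<Union>\<F>'"]) auto
qed

section \<open>Concentration and characteristic functions\<close>

lemma sum_geometric_distance_le:
  "(\<Sum>l<n. (1/2 :: real) ^ nat \<bar>int k - int l\<bar>) \<le> 3"
proof -
  have split: "{..<n} \<subseteq> {..k} \<union> {k<..<k + n + 1}" by auto
  have "(\<Sum>l<n. (1/2 :: real) ^ nat \<bar>int k - int l\<bar>)
      \<le> (\<Sum>l\<in>{..k} \<union> {k<..<k + n + 1}. (1/2) ^ nat \<bar>int k - int l\<bar>)"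
    by (rule sum_mono2[OF _ split]) auto
  also have "\<dots> = (\<Sum>l\<le>k. (1/2) ^ nat \<bar>int k - int l\<bar>) + (\<Sum>l\<in>{k<..<k + n + 1}. (1/2) ^ nat \<bar>int k - int l\<bar>)"
    by (rule sum.union_disjoint) auto
  also have "(\<Sum>l\<le>k. (1/2 :: real) ^ nat \<bar>int k - int l\<bar>) = (\<Sum>d<Suc k. (1/2) ^ d)"
    by (rule sum.reindex_bij_witness[where i = "\<lambda>d. k - d" and j = "\<lambda>l. k - l"])
       (auto simp: nat_diff_distrib of_nat_diff[symmetric] simp del: of_nat_diff)
  also have "\<dots> \<le> 2"
    by (subst geometric_sum) (auto simp: field_simps)
  also have "(\<Sum>l\<in>{k<..<k + n + 1}. (1/2 :: real) ^ nat \<bar>int k - int l\<bar>) = (\<Sum>d<n. (1/2) ^ Suc d)"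
    by (rule sum.reindex_bij_witness[where i = "\<lambda>d. k + Suc d" and j = "\<lambda>l. l - Suc k"])
       (auto simp: Suc_diff_Suc nat_diff_distrib' simp flip: of_nat_diff)
  also have "\<dots> \<le> 1"
    by (subst power_Suc, subst sum_distrib_left[symmetric], subst geometric_sum) (auto simp: field_simps)
  finally show ?thesis by simp
qed

text \<open>
  This is the squared modulus of \<open>\<Sum>k<n. exp (\<i> * k * x)\<close>. Its left-hand form shows that it is
  nonnegative and large near 0, its right-hand form that its expectation at a random \<open>x\<close> is a sum
  of values of the characteristic function.
\<close>

lemma power2_sum_cos_sin:
  fixes x :: real
  shows "(\<Sum>k<n. cos (of_nat k * x))\<^sup>2 + (\<Sum>k<n. sin (of_nat k * x))\<^sup>2
    = (\<Sum>k<n. \<Sum>l<n. cos ((of_nat k - of_nat l) * x))"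
  by (simp add: power2_eq_square sum_product sum.distrib[symmetric] left_diff_distrib cos_diff)

lemma cos_ge_half:
  fixes y :: real
  assumes "\<bar>y\<bar> \<le> 1"
  shows "1 / 2 \<le> cos y"
proof -
  have "cos 1 \<le> cos \<bar>y\<bar>"
    using assms pi_gt3 by (intro cos_monotone_0_pi_le) auto
  moreover have "cos (pi/3) \<le> cos 1"
    using pi_gt3 by (intro cos_monotone_0_pi_le) auto
  ultimately show ?thesis by (simp add: cos_60)
qed

context prob_space
begin

lemma expectation_cos_eq_char:
  assumes [measurable]: "X \<in> borel_measurable M"
  shows "expectation (\<lambda>\<omega>. cos (t * X \<omega>)) = Re (char (distr M borel X) t)"
proof -
  have i: "integrable M (\<lambda>\<omega>. iexp (t * X \<omega>))"
    by (rule integrable_iexp) (auto simp flip: of_real_mult)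
  have "char (distr M borel X) t = expectation (\<lambda>\<omega>. iexp (t * X \<omega>))"
    by (simp add: char_def integral_distr)
  also have "Re \<dots> = expectation (\<lambda>\<omega>. Re (iexp (t * X \<omega>)))"
    using i by simp
  finally show ?thesis by (simp add: Re_exp)
qed

text \<open>
  A discrete form of Esseen's inequality. Let \<open>E\<close> be the squared modulus of the sum of
  \<open>exp (\<i> * k * h * X)\<close> over \<open>k < n\<close>, with \<open>n * h\<close> about \<open>T\<close>. On the event all the phases are at most 1,
  so that \<open>E \<ge> n\<^sup>2 / 4\<close>. On the other hand the expectation of \<open>E\<close> is the sum of the characteristic
  function at \<open>(k - l) * h\<close>, and for \<open>h = 1 / sqrt a\<close> the assumed decay makes this \<open>O(n)\<close>. Sampling the
  frequencies on a grid replaces the double integral of the usual proof by a finite sum.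
\<close>

lemma concentration_le_char_decay:
  assumes [measurable]: "X \<in> borel_measurable M"
    and "0 < a" "0 < T"
    and decay: "\<And>t. \<bar>t\<bar> \<le> T \<Longrightarrow> cmod (char (distr M borel X) t) \<le> exp (- a * t\<^sup>2)"
  shows "\<P>(\<omega> in M. \<bar>X \<omega>\<bar> \<le> 1 / T) \<le> 12 / (T * sqrt a)"
proof -
  define h where "h = 1 / sqrt a"
  have h: "0 < h" "a * h\<^sup>2 = 1" using \<open>0 < a\<close> by (auto simp: h_def power_divide)
  \<comment> \<open>the frequencies \<open>k * h\<close> with \<open>k < n\<close> stay below \<open>T\<close>, while \<open>n * h\<close> is at least \<open>T\<close>\<close>
  define n where "n = nat \<lceil>T * sqrt a\<rceil>"
  have Ta: "0 < T * sqrt a" using assms by simp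
  have n: "0 < n" "T * sqrt a \<le> real n" "real (n - 1) < T * sqrt a"
    using Ta unfolding n_def by linarith+
  have grid: "real k * h \<le> T" if "k < n" for k
  proof -
    have "real k \<le> T * sqrt a" using that n(3) by linarith
    then show ?thesis using \<open>0 < a\<close> by (simp add: h_def field_simps)
  qed
  define E where "E \<omega> = (\<Sum>k<n. cos (real k * (h * X \<omega>)))\<^sup>2 + (\<Sum>k<n. sin (real k * (h * X \<omega>)))\<^sup>2" for \<omega>
  have E_eq: "E \<omega> = (\<Sum>k<n. \<Sum>l<n. cos ((real k - real l) * h * X \<omega>))" for \<omega>
    unfolding E_def power2_sum_cos_sin by (simp add: mult_ac)
  have icos: "integrable M (\<lambda>\<omega>. cos (t * X \<omega>))" for t
    by (rule integrable_const_bound[where B = 1]) auto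
  have E_int: "integrable M E"
    unfolding E_eq by (intro Bochner_Integration.integrable_sum icos)
  have "expectation E = (\<Sum>k<n. \<Sum>l<n. Re (char (distr M borel X) ((real k - real l) * h)))"
    unfolding E_eq by (simp add: icos Bochner_Integration.integral_sum expectation_cos_eq_char)
  also have "\<dots> \<le> (\<Sum>k<n. \<Sum>l<n. (1/2) ^ nat \<bar>int k - int l\<bar>)"
  proof (intro sum_mono)
    fix k l assume kl: "k \<in> {..<n}" "l \<in> {..<n}"
    define d where "d = nat \<bar>int k - int l\<bar>"
    have d: "real d = \<bar>real k - real l\<bar>" by (simp add: d_def)
    have "d < n" using kl by (auto simp: d_def)
    then have "\<bar>(real k - real l) * h\<bar> \<le> T"
      using grid[of d] h d by (simp add: abs_mult)
    then have "Re (char (distr M borel X) ((real k - real l) * h)) \<le> exp (- a * ((real k - real l) * h)\<^sup>2)"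
      using decay complex_Re_le_cmod order_trans by blast
    also have "a * ((real k - real l) * h)\<^sup>2 = (real d)\<^sup>2"
    proof -
      have "a * ((real k - real l) * h)\<^sup>2 = (a * h\<^sup>2) * (real k - real l)\<^sup>2"
        unfolding power_mult_distrib by (simp only: mult_ac)
      then show ?thesis using h d by simp
    qed
    then have "exp (- a * ((real k - real l) * h)\<^sup>2) = exp (- (real d)\<^sup>2)" by simp
    also have "\<dots> \<le> exp (- real d)"
      by (cases d) (auto simp: power2_eq_square algebra_simps)
    also have "\<dots> = exp (-1) ^ d" by (simp flip: exp_of_nat_mult)
    also have "\<dots> \<le> (1/2) ^ d"
    proof (rule power_mono)
      have "2 \<le> exp (1::real)" using exp_ge_add_one_self[of 1] by simp
      then show "exp (-1) \<le> (1/2::real)" by (simp add: exp_minus field_simps)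
    qed auto
    finally show "Re (char (distr M borel X) ((real k - real l) * h)) \<le> (1/2) ^ nat \<bar>int k - int l\<bar>"
      by (simp add: d_def)
  qed
  also have "\<dots> \<le> (\<Sum>k<n. 3)" by (intro sum_mono sum_geometric_distance_le)
  finally have upper: "expectation E \<le> 3 * real n" by simp
  \<comment> \<open>Markov's inequality for \<open>E\<close>\<close>
  have "(real n)\<^sup>2 / 4 * \<P>(\<omega> in M. \<bar>X \<omega>\<bar> \<le> 1 / T)
      = expectation (\<lambda>\<omega>. (real n)\<^sup>2 / 4 * indicator {\<omega>\<in>space M. \<bar>X \<omega>\<bar> \<le> 1 / T} \<omega>)"
    by simp
  also have "\<dots> \<le> expectation E"
  proof (rule integral_mono[OF _ E_int])
    fix \<omega> assume "\<omega> \<in> space M"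
    show "(real n)\<^sup>2 / 4 * indicator {\<omega>\<in>space M. \<bar>X \<omega>\<bar> \<le> 1 / T} \<omega> \<le> E \<omega>"
    proof (cases "\<bar>X \<omega>\<bar> \<le> 1 / T")
      case True
      have "1 / 2 \<le> cos (real k * (h * X \<omega>))" if "k < n" for k
      proof (rule cos_ge_half)
        have "\<bar>real k * (h * X \<omega>)\<bar> = (real k * h) * \<bar>X \<omega>\<bar>"
          using h by (simp add: abs_mult)
        also have "\<dots> \<le> T * (1 / T)"
          using grid[OF that] True h \<open>0 < T\<close> by (intro mult_mono) auto
        finally show "\<bar>real k * (h * X \<omega>)\<bar> \<le> 1" using \<open>0 < T\<close> by simp
      qed
      then have "(\<Sum>k<n. 1 / 2) \<le> (\<Sum>k<n. cos (real k * (h * X \<omega>)))"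
        by (intro sum_mono) auto
      then have "(real n / 2)\<^sup>2 \<le> (\<Sum>k<n. cos (real k * (h * X \<omega>)))\<^sup>2"
        by (intro power_mono) auto
      then have "(real n / 2)\<^sup>2 \<le> E \<omega>"
        unfolding E_def by (simp add: add_increasing2)
      then show ?thesis by (simp add: power_divide indicator_def E_def)
    qed (auto simp: E_def)
  qed (auto intro!: integrable_mult_right simp: emeasure_eq_measure)
  finally have "(real n)\<^sup>2 / 4 * \<P>(\<omega> in M. \<bar>X \<omega>\<bar> \<le> 1 / T) \<le> 3 * real n"
    using upper by linarith
  then have "\<P>(\<omega> in M. \<bar>X \<omega>\<bar> \<le> 1 / T) \<le> 12 / real n"
    using n(1) by (simp add: power2_eq_square field_simps)
  also have "\<dots> \<le> 12 / (T * sqrt a)"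
    using n Ta by (intro divide_left_mono) auto
  finally show ?thesis .
qed

text \<open>
  Second-order Taylor expansion of the characteristic function of the centred variable: as it is
  bounded by 1, its third absolute moment is at most its variance, so for \<open>\<bar>t\<bar> \<le> 1\<close> the error term
  eats up only a third of the quadratic term.
\<close>

lemma cmod_char_le_near_zero:
  assumes [measurable]: "X \<in> borel_measurable M"
    and bounded: "AE \<omega> in M. 0 \<le> X \<omega> \<and> X \<omega> \<le> 1"
    and "\<bar>t\<bar> \<le> 1"
  shows "cmod (char (distr M borel X) t) \<le> exp (- variance X * t\<^sup>2 / 3)"
proof -
  define m where "m = expectation X"
  have X_int: "integrable M X"
    using bounded by (intro integrable_const_bound[where B = 1]) auto
  have m: "0 \<le> m" "m \<le> 1"
    unfolding m_def using bounded X_int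
    by (auto intro!: integral_nonneg_AE integral_le_const)
  define Y where "Y \<omega> = X \<omega> - m" for \<omega>
  have [measurable]: "Y \<in> borel_measurable M" unfolding Y_def by measurable
  have Y1: "AE \<omega> in M. \<bar>Y \<omega>\<bar> \<le> 1"
    using bounded by (rule eventually_mono) (use m in \<open>auto simp: Y_def abs_le_iff\<close>)
  have Y_int: "integrable M Y" using Y1 by (intro integrable_const_bound[where B = 1]) auto
  have Y2_int: "integrable M (\<lambda>\<omega>. (Y \<omega>)\<^sup>2)"
    using Y1 by (intro integrable_const_bound[where B = 1]) (auto simp: abs_square_le_1)
  have EY: "expectation Y = 0"
    unfolding Y_def using X_int by (simp add: prob_space m_def)
  have VY: "expectation (\<lambda>\<omega>. (Y \<omega>)\<^sup>2) = variance X" by (simp add: Y_def m_def)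
  have "cmod (char (distr M borel Y) t - (1 - t\<^sup>2 * variance X / 2)) \<le>
      (t\<^sup>2 / 6) * expectation (\<lambda>\<omega>. min (6 * (Y \<omega>)\<^sup>2) (\<bar>t\<bar> * \<bar>Y \<omega>\<bar> ^ 3))"
    using Y_int Y2_int EY VY by (intro char_approx3') auto
  also have "expectation (\<lambda>\<omega>. min (6 * (Y \<omega>)\<^sup>2) (\<bar>t\<bar> * \<bar>Y \<omega>\<bar> ^ 3))
      \<le> expectation (\<lambda>\<omega>. (Y \<omega>)\<^sup>2)"
  proof (rule integral_mono_AE[OF _ Y2_int])
    show le: "AE \<omega> in M. min (6 * (Y \<omega>)\<^sup>2) (\<bar>t\<bar> * \<bar>Y \<omega>\<bar> ^ 3) \<le> (Y \<omega>)\<^sup>2"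
      using Y1
    proof (rule eventually_mono)
      fix \<omega> assume "\<bar>Y \<omega>\<bar> \<le> 1"
      then have "(\<bar>t\<bar> * \<bar>Y \<omega>\<bar>) * \<bar>Y \<omega>\<bar>\<^sup>2 \<le> 1 * \<bar>Y \<omega>\<bar>\<^sup>2"
        using \<open>\<bar>t\<bar> \<le> 1\<close> by (intro mult_right_mono mult_le_one) auto
      then show "min (6 * (Y \<omega>)\<^sup>2) (\<bar>t\<bar> * \<bar>Y \<omega>\<bar> ^ 3) \<le> (Y \<omega>)\<^sup>2"
        by (simp add: power3_eq_cube power2_eq_square mult_ac)
    qed
    show "integrable M (\<lambda>\<omega>. min (6 * (Y \<omega>)\<^sup>2) (\<bar>t\<bar> * \<bar>Y \<omega>\<bar> ^ 3))"
      by (rule Bochner_Integration.integrable_bound[OF Y2_int]) (use le in auto)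
  qed
  finally have approx: "cmod (char (distr M borel Y) t - (1 - t\<^sup>2 * variance X / 2)) \<le> t\<^sup>2 / 6 * variance X"
    unfolding VY by (simp add: mult_left_mono)
  have var1: "variance X \<le> 1"
    unfolding VY[symmetric] using Y1 Y2_int
    by (intro integral_le_const) (auto simp: abs_square_le_1)
  have t1: "t\<^sup>2 \<le> 1" using \<open>\<bar>t\<bar> \<le> 1\<close> by (simp add: abs_square_le_1)
  have tv: "t\<^sup>2 * variance X \<le> 1"
    using t1 var1 variance_positive[of X] by (intro mult_le_one) auto
  have "cmod (char (distr M borel Y) t) \<le> cmod (char (distr M borel Y) t - (1 - t\<^sup>2 * variance X / 2))
      + cmod (complex_of_real (1 - t\<^sup>2 * variance X / 2))"
    using norm_triangle_sub[of "char (distr M borel Y) t" "complex_of_real (1 - t\<^sup>2 * variance X / 2)"]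
    by (simp add: add.commute)
  also have "cmod (complex_of_real (1 - t\<^sup>2 * variance X / 2)) = 1 - t\<^sup>2 * variance X / 2"
    unfolding norm_of_real using tv by simp
  also have "cmod (char (distr M borel Y) t - (1 - t\<^sup>2 * variance X / 2)) + (1 - t\<^sup>2 * variance X / 2)
     \<le> 1 + (- variance X * t\<^sup>2 / 3)"
    using approx by (simp add: field_simps)
  also have "\<dots> \<le> exp (- variance X * t\<^sup>2 / 3)" by (rule exp_ge_add_one_self)
  finally have *: "cmod (char (distr M borel Y) t) \<le> exp (- variance X * t\<^sup>2 / 3)" .
  \<comment> \<open>undoing the centring only multiplies by a phase\<close>
  have "char (distr M borel X) t = expectation (\<lambda>\<omega>. iexp (t * m) * iexp (t * Y \<omega>))"
    by (simp add: char_def integral_distr Y_def flip: exp_add) (simp add: algebra_simps)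
  also have "\<dots> = iexp (t * m) * char (distr M borel Y) t"
    by (simp add: char_def integral_distr)
  finally show ?thesis using * by (simp add: norm_mult)
qed

end

section \<open>Two real inequalities\<close>

lemma exp_minus_le_chord:
  fixes y L :: real
  assumes "0 \<le> y" "y \<le> L"
  shows "exp (- y) \<le> 1 - y / (1 + L)"
proof -
  have "1 \<le> (1 - y / (1 + L)) * (1 + y)"
  proof -
    have "(1 - y / (1 + L)) * (1 + y) = 1 + y * (L - y) / (1 + L)"
      using assms by (simp add: field_simps)
    then show ?thesis using assms by simp
  qed
  also have "\<dots> \<le> (1 - y / (1 + L)) * exp y"
    using assms by (intro mult_left_mono exp_ge_add_one_self) (simp add: field_simps)
  finally show ?thesis by (simp add: exp_minus field_simps)
qed

text \<open>
  Doubling an output \<open>y \<le> c\<close> fails to double the sales only when the remaining demand \<open>u\<close> is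
  within \<open>2 * c\<close> of 0, and then at most \<open>c\<close> is missing.
\<close>

lemma double_min_le:
  fixes u y c :: real
  assumes "0 \<le> y" "y \<le> c"
  shows "2 * min (max u 0) y \<le> min (max u 0) (2 * y) + c * (if \<bar>u\<bar> \<le> 2 * c then 1 else 0)"
  using assms by (auto simp: min_def max_def)

section \<open>The largest producer\<close>

lemma largest_producer:
  assumes "0 < N"
  shows "largest_producer N C < N" and "j < N \<Longrightarrow> C j \<le> C (largest_producer N C)"
proof -
  let ?A = "{i. i < N \<and> (\<forall>j<N. C j \<le> C i)}"
  have "Max (C ` {..<N}) \<in> C ` {..<N}" using assms by (intro Max_in) auto
  then obtain i where "i < N" "C i = Max (C ` {..<N})" by auto
  then have "i \<in> ?A" by auto
  moreover have "finite ?A" by simp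
  ultimately have "largest_producer N C \<in> ?A"
    unfolding largest_producer_def by (intro Max_in) auto
  then show "largest_producer N C < N" and "j < N \<Longrightarrow> C j \<le> C (largest_producer N C)" by auto
qed

lemma largest_producer_eqI:
  assumes "i < N" "\<And>j. j < N \<Longrightarrow> j \<noteq> i \<Longrightarrow> C j < C i"
  shows "largest_producer N C = i"
proof -
  have "{i. i < N \<and> (\<forall>j<N. C j \<le> C i)} = {i}"
    using assms by (force simp: order.order_iff_strict)
  then show ?thesis by (simp add: largest_producer_def)
qed

lemma largest_producer_fun_upd_less:
  assumes "i < N" "x < C (largest_producer N C)" "i \<noteq> largest_producer N C"
  shows "largest_producer N (C(i := x)) = largest_producer N C"
proof -
  let ?m = "largest_producer N C"
  have m: "?m < N" "\<And>j. j < N \<Longrightarrow> C j \<le> C ?m"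
    using largest_producer[of N] assms(1) by auto
  show ?thesis
    unfolding largest_producer_def[of N "C(i := x)"]
  proof (rule Max_eqI)
    fix k assume k: "k \<in> {k. k < N \<and> (\<forall>j<N. (C(i := x)) j \<le> (C(i := x)) k)}"
    then have "(C(i := x)) ?m \<le> (C(i := x)) k" using m by blast
    then have "k \<noteq> i" "C k = C ?m" using k m assms by (auto split: if_splits intro: antisym)
    then have "k \<in> {i. i < N \<and> (\<forall>j<N. C j \<le> C i)}" using k m by auto
    then show "k \<le> ?m" unfolding largest_producer_def by (intro Max_ge) auto
  qed (use m assms in \<open>auto intro: less_imp_le\<close>)
qed

section \<open>Payments and the common price level\<close>

text \<open>
  The supply enters the argument through its range, its mean and its variance: the mean governs what
  a producer sells, and the variance the spread of the total output.
\<close>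

locale random_supply = prob_space M for M :: "'a measure" +
  fixes D :: "'a \<Rightarrow> real" and Z :: "nat \<Rightarrow> 'a \<Rightarrow> real" and Dmin Dmax \<mu> v \<gamma> :: real
  assumes D_measurable [measurable]: "D \<in> borel_measurable M"
    and Dmin_pos: "0 < Dmin"
    and D_bounds: "AE \<omega> in M. Dmin \<le> D \<omega> \<and> D \<omega> \<le> Dmax"
    and indep: "indep_vars (\<lambda>_. borel) (case_nat D Z) UNIV"
    and Z_unit: "\<And>i. AE \<omega> in M. 0 \<le> Z i \<omega> \<and> Z i \<omega> \<le> 1"
    and Z_mean: "\<And>i. expectation (Z i) = \<mu>"
    and Z_variance: "\<And>i. variance (Z i) = v"
    and mean_pos: "0 < \<mu>"
    and variance_pos: "0 < v"
    and cost_pos: "0 < \<gamma>"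
begin

lemma Z_measurable [measurable]: "Z i \<in> borel_measurable M"
proof -
  have "case_nat D Z (Suc i) \<in> borel_measurable M"
    using indep unfolding indep_vars_def by (metis UNIV_I)
  then show ?thesis by simp
qed

definition typical :: "'a \<Rightarrow> bool" where
  "typical \<omega> \<longleftrightarrow> Dmin \<le> D \<omega> \<and> D \<omega> \<le> Dmax \<and> (\<forall>i. 0 \<le> Z i \<omega> \<and> Z i \<omega> \<le> 1)"

lemma AE_typical: "AE \<omega> in M. typical \<omega>"
  unfolding typical_def using D_bounds Z_unit by (simp add: AE_all_countable)

lemma Dmin_le_Dmax: "Dmin \<le> Dmax"
proof -
  have "AE \<omega> in M. Dmin \<le> Dmax" using D_bounds by (rule eventually_mono) auto
  then show ?thesis by simp
qed

lemma integrable_Z [simp]: "integrable M (Z i)"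
  using Z_unit[of i] by (intro integrable_const_bound[where B = 1]) auto

definition sales :: "nat \<Rightarrow> real \<Rightarrow> real" where
  "sales i x = expectation (\<lambda>\<omega>. min (x * Z i \<omega>) (D \<omega>))"

definition others_output :: "nat \<Rightarrow> (nat \<Rightarrow> real) \<Rightarrow> nat \<Rightarrow> 'a \<Rightarrow> real" where
  "others_output N C i \<omega> = (\<Sum>j\<in>{..<N} - {i}. Z j \<omega> * C j)"

definition residual_sales :: "nat \<Rightarrow> (nat \<Rightarrow> real) \<Rightarrow> nat \<Rightarrow> real \<Rightarrow> real" where
  "residual_sales N C i x = expectation (\<lambda>\<omega>. min (max (D \<omega> - others_output N C i \<omega>) 0) (Z i \<omega> * x))"

text \<open>
  The factor by which all payments fall short of the expected sales of producers who are alone in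
  the market.
\<close>

definition price_level :: "nat \<Rightarrow> (nat \<Rightarrow> real) \<Rightarrow> real" where
  "price_level N C = (let m = largest_producer N C in residual_sales N C m (C m) / sales m (C m))"

lemma others_output_measurable [measurable]: "others_output N C i \<in> borel_measurable M"
  unfolding others_output_def by measurable

lemma others_output_cong:
  "(\<And>j. j < N \<Longrightarrow> j \<noteq> i \<Longrightarrow> C j = C' j) \<Longrightarrow> others_output N C i = others_output N C' i"
  unfolding others_output_def by (auto intro!: sum.cong)

lemma others_output_nonneg:
  "(\<And>j. j < N \<Longrightarrow> 0 \<le> C j) \<Longrightarrow> (\<And>i. 0 \<le> Z i \<omega>) \<Longrightarrow> 0 \<le> others_output N C i \<omega>"
  unfolding others_output_def by (auto intro!: sum_nonneg)

lemma integrable_sales: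
  assumes "0 \<le> x"
  shows "integrable M (\<lambda>\<omega>. min (x * Z i \<omega>) (D \<omega>))"
proof (rule integrable_const_bound)
  show "AE \<omega> in M. norm (min (x * Z i \<omega>) (D \<omega>)) \<le> Dmax"
    using AE_typical
    by (rule eventually_mono) (use Dmin_pos assms in \<open>auto simp: typical_def min_def intro: order_trans\<close>)
qed measurable

lemma integrable_residual:
  assumes "0 \<le> x"
  shows "integrable M (\<lambda>\<omega>. min (max (D \<omega> - others_output N C i \<omega>) 0) (Z i \<omega> * x))"
proof (rule Bochner_Integration.integrable_bound)
  show "integrable M (\<lambda>\<omega>. Z i \<omega> * x)" by simp
  show "AE \<omega> in M. norm (min (max (D \<omega> - others_output N C i \<omega>) 0) (Z i \<omega> * x)) \<le> norm (Z i \<omega> * x)"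
    using AE_typical by (rule eventually_mono) (use assms in \<open>auto simp: typical_def\<close>)
qed measurable

lemma sales_0 [simp]: "sales i 0 = 0"
proof -
  have "expectation (\<lambda>\<omega>. min (0 * Z i \<omega>) (D \<omega>)) = expectation (\<lambda>_. 0)"
    by (intro integral_cong_AE eventually_mono[OF AE_typical])
       (use Dmin_pos in \<open>auto simp: typical_def\<close>)
  then show ?thesis by (simp add: sales_def)
qed

lemma sales_le: "0 \<le> x \<Longrightarrow> sales i x \<le> \<mu> * x"
proof -
  assume "0 \<le> x"
  then have "sales i x \<le> expectation (\<lambda>\<omega>. x * Z i \<omega>)"
    unfolding sales_def by (intro integral_mono integrable_sales) auto
  then show ?thesis by (simp add: Z_mean mult.commute)
qed

lemma sales_le_Dmax: "0 \<le> x \<Longrightarrow> sales i x \<le> Dmax"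
  unfolding sales_def
  by (intro integral_le_const integrable_sales eventually_mono[OF AE_typical])
     (auto simp: typical_def min_le_iff_disj)

lemma sales_ge: "0 \<le> x \<Longrightarrow> \<mu> * min x Dmin \<le> sales i x"
proof -
  assume x: "0 \<le> x"
  have "expectation (\<lambda>\<omega>. min x Dmin * Z i \<omega>) \<le> sales i x"
    unfolding sales_def
  proof (rule integral_mono_AE[OF _ integrable_sales[OF x]])
    show "AE \<omega> in M. min x Dmin * Z i \<omega> \<le> min (x * Z i \<omega>) (D \<omega>)"
      using AE_typical
    proof (rule eventually_mono)
      fix \<omega> assume "typical \<omega>"
    then have \<omega>: "Dmin \<le> D \<omega> \<and> D \<omega> \<le> Dmax \<and> (\<forall>i. 0 \<le> Z i \<omega> \<and> Z i \<omega> \<le> 1)"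
      by (simp add: typical_def)
      have "min x Dmin * Z i \<omega> \<le> x * Z i \<omega>" using \<omega> by (intro mult_right_mono) auto
      moreover have "min x Dmin * Z i \<omega> \<le> Dmin * 1"
        using \<omega> x Dmin_pos by (intro mult_mono) auto
      ultimately show "min x Dmin * Z i \<omega> \<le> min (x * Z i \<omega>) (D \<omega>)" using \<omega> by auto
    qed
  qed simp
  then show ?thesis by (simp add: Z_mean mult.commute)
qed

lemma sales_nonneg: "0 \<le> x \<Longrightarrow> 0 \<le> sales i x"
  using sales_ge[of x i] mean_pos Dmin_pos mult_nonneg_nonneg[of \<mu> "min x Dmin"] by linarith

lemma sales_pos: "0 < x \<Longrightarrow> 0 < sales i x"
  using sales_ge[of x i] mean_pos Dmin_pos mult_pos_pos[of \<mu> "min x Dmin"] by linarith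

lemma sales_eq_mean: "0 \<le> x \<Longrightarrow> x \<le> Dmin \<Longrightarrow> sales i x = \<mu> * x"
  using sales_ge[of x i] sales_le[of x i] by simp

lemma residual_sales_nonneg: "0 \<le> x \<Longrightarrow> 0 \<le> residual_sales N C i x"
  unfolding residual_sales_def
  by (intro integral_nonneg_AE eventually_mono[OF AE_typical]) (auto simp: typical_def)

lemma residual_sales_le_sales:
  assumes "\<And>j. j < N \<Longrightarrow> 0 \<le> C j" "0 \<le> x"
  shows "residual_sales N C i x \<le> sales i x"
  unfolding residual_sales_def sales_def
proof (rule integral_mono_AE[OF integrable_residual[OF assms(2)] integrable_sales[OF assms(2)]])
  show "AE \<omega> in M. min (max (D \<omega> - others_output N C i \<omega>) 0) (Z i \<omega> * x) \<le> min (x * Z i \<omega>) (D \<omega>)"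
    using AE_typical
  proof (rule eventually_mono)
    fix \<omega> assume "typical \<omega>"
    then have \<omega>: "Dmin \<le> D \<omega> \<and> D \<omega> \<le> Dmax \<and> (\<forall>i. 0 \<le> Z i \<omega> \<and> Z i \<omega> \<le> 1)"
      by (simp add: typical_def)
    then have "0 \<le> others_output N C i \<omega>" using assms by (intro others_output_nonneg) auto
    then show "min (max (D \<omega> - others_output N C i \<omega>) 0) (Z i \<omega> * x) \<le> min (x * Z i \<omega>) (D \<omega>)"
      using \<omega> Dmin_pos by (auto simp: mult.commute)
  qed
qed

lemma payment_eq:
  assumes "\<And>j. j < N \<Longrightarrow> 0 \<le> C j" "\<exists>j<N. C j \<noteq> 0"
  shows "payment M D Z N C i = price_level N C * sales i (C i)"
proof -
  define m where "m = largest_producer N C"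
  obtain j where j: "j < N" "C j \<noteq> 0" using assms by auto
  then have "0 < C m"
    using largest_producer(2)[of N j C] assms(1)[of j] unfolding m_def by linarith
  then have "0 < sales m (C m)" by (rule sales_pos)
  moreover have "\<not> (\<forall>j<N. C j = 0)" using j by auto
  ultimately show ?thesis
    unfolding payment_def price_level_def Let_def m_def
    by (auto simp: sales_def residual_sales_def others_output_def)
qed

lemma price_level_bounds:
  assumes "\<And>j. j < N \<Longrightarrow> 0 \<le> C j" "0 < N"
  shows "0 \<le> price_level N C" "price_level N C \<le> 1"
proof -
  define m where "m = largest_producer N C"
  have "0 \<le> C m" using assms largest_producer(1)[of N] by (simp add: m_def)
  then show "0 \<le> price_level N C" "price_level N C \<le> 1"
    using residual_sales_le_sales[of N C "C m" m] residual_sales_nonneg[of "C m" N C m] sales_nonneg[of "C m" m] assms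
    by (auto simp: price_level_def Let_def m_def[symmetric] divide_le_eq_1)
qed

lemma payment_bounds:
  assumes "\<And>j. j < N \<Longrightarrow> 0 \<le> C j" "i < N"
  shows "0 \<le> payment M D Z N C i" "payment M D Z N C i \<le> \<mu> * C i"
proof -
  have "0 \<le> payment M D Z N C i \<and> payment M D Z N C i \<le> \<mu> * C i"
  proof (cases "\<exists>j<N. C j \<noteq> 0")
    case True
    have "price_level N C * sales i (C i) \<le> 1 * sales i (C i)"
      using price_level_bounds[of N C] sales_nonneg[of "C i" i] assms by (intro mult_right_mono) auto
    then show ?thesis
      using payment_eq[OF assms(1) True] price_level_bounds[of N C] sales_nonneg[of "C i" i] sales_le[of "C i" i] assms
      by auto
  qed (use assms in \<open>auto simp: payment_def\<close>)
  then show "0 \<le> payment M D Z N C i" "payment M D Z N C i \<le> \<mu> * C i" by auto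
qed

lemma payment_largest:
  assumes "\<And>j. j < N \<Longrightarrow> 0 \<le> C j" "\<exists>j<N. C j \<noteq> 0" "m = largest_producer N C"
  shows "payment M D Z N C m = residual_sales N C m (C m)"
  using assms(2) unfolding payment_def Let_def assms(3)[symmetric]
  by (auto simp: residual_sales_def others_output_def)

text \<open>
  The demand left over by the others does not depend on the own capacity, so deviations that make
  a producer the largest one have an explicit payment.
\<close>

lemma payment_become_largest:
  assumes "\<And>j. j < N \<Longrightarrow> 0 \<le> C j" "i < N" "0 < x" "\<And>j. j < N \<Longrightarrow> C j < x"
  shows "payment M D Z N (C(i := x)) i = residual_sales N C i x"
proof -
  have "largest_producer N (C(i := x)) = i" using assms by (intro largest_producer_eqI) auto
  moreover have "others_output N (C(i := x)) i = others_output N C i"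
    by (rule others_output_cong) auto
  moreover have "payment M D Z N (C(i := x)) i = residual_sales N (C(i := x)) i ((C(i := x)) i)"
    using assms calculation by (intro payment_largest) (auto intro!: exI[of _ i])
  ultimately show ?thesis by (simp add: residual_sales_def)
qed

section \<open>Sums of independent outputs\<close>

lemma expectation_exp_minus_output_le:
  assumes "0 \<le> c" "c \<le> L"
  shows "expectation (\<lambda>\<omega>. exp (- (c * Z j \<omega>))) \<le> exp (- (\<mu> / (1 + L)) * c)"
proof -
  have int: "integrable M (\<lambda>\<omega>. exp (- (c * Z j \<omega>)))"
    by (rule integrable_const_bound[where B = 1], rule eventually_mono[OF AE_typical])
       (use assms in \<open>auto simp: typical_def\<close>)
  have "expectation (\<lambda>\<omega>. exp (- (c * Z j \<omega>))) \<le> expectation (\<lambda>\<omega>. 1 - c / (1 + L) * Z j \<omega>)"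
  proof (rule integral_mono_AE[OF int], simp, rule eventually_mono[OF AE_typical])
    fix \<omega> assume "typical \<omega>"
    then have "0 \<le> c * Z j \<omega>" "c * Z j \<omega> \<le> L"
      using assms mult_left_le[of "Z j \<omega>" c] by (auto simp: typical_def)
    then show "exp (- (c * Z j \<omega>)) \<le> 1 - c / (1 + L) * Z j \<omega>"
      using exp_minus_le_chord[of "c * Z j \<omega>" L] by simp
  qed
  also have "\<dots> = 1 + (- (\<mu> / (1 + L)) * c)" by (simp add: prob_space Z_mean)
  also have "\<dots> \<le> exp (- (\<mu> / (1 + L)) * c)" by (rule exp_ge_add_one_self)
  finally show ?thesis .
qed

text \<open>
  The exponential discount stands in for the event that the other producers leave some demand: by
  independence its expectation factorises, and every factor is bounded by the previous lemma.
\<close>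

lemma expectation_output_discounted_le:
  assumes "\<And>j. j < N \<Longrightarrow> 0 \<le> C j" "\<And>j. j < N \<Longrightarrow> C j \<le> L" "m < N"
  shows "integrable M (\<lambda>\<omega>. Z m \<omega> * exp (- others_output N C m \<omega>))"
    and "expectation (\<lambda>\<omega>. Z m \<omega> * exp (- others_output N C m \<omega>))
      \<le> \<mu> * exp (- (\<mu> / (1 + L)) * (\<Sum>j\<in>{..<N} - {m}. C j))"
proof -
  let ?J = "{..<N} - {m}"
  \<comment> \<open>index 0 belongs to the demand and index \<open>Suc j\<close> to producer \<open>j\<close>\<close>
  define Y where "Y k x = (if k = Suc m then x else exp (- (C (k - 1) * x)))" for k and x :: real
  define X where "X k \<omega> = Y k (case_nat D Z k \<omega>)" for k \<omega>
  have [measurable]: "Y k \<in> borel_measurable borel" for k unfolding Y_def by measurable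
  have XS: "X (Suc j) \<omega> = (if j = m then Z m \<omega> else exp (- (C j * Z j \<omega>)))" for j \<omega>
    by (auto simp: X_def Y_def)
  have ind: "indep_vars (\<lambda>_. borel) X (Suc ` {..<N})"
    unfolding X_def by (rule indep_vars_compose2[OF indep_vars_subset[OF indep]]) auto
  have [measurable]: "X k \<in> borel_measurable M" for k
  proof -
    have [measurable]: "case_nat D Z k \<in> borel_measurable M"
      by (cases k) (simp_all add: D_measurable Z_measurable)
    show ?thesis unfolding X_def by measurable
  qed
  have int: "integrable M (X k)" if "k \<in> Suc ` {..<N}" for k
  proof (rule integrable_const_bound[where B = 1], rule eventually_mono[OF AE_typical])
    fix \<omega> assume "typical \<omega>"
    then show "norm (X k \<omega>) \<le> 1" using that assms by (auto simp: XS typical_def)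
  qed measurable
  have prod_eq: "(\<Prod>k\<in>Suc ` {..<N}. X k \<omega>) = Z m \<omega> * exp (- others_output N C m \<omega>)" for \<omega>
  proof -
    have "(\<Prod>k\<in>Suc ` {..<N}. X k \<omega>) = (\<Prod>j<N. X (Suc j) \<omega>)" by (simp add: prod.reindex)
    also have "\<dots> = X (Suc m) \<omega> * (\<Prod>j\<in>?J. X (Suc j) \<omega>)"
      using assms(3) by (intro prod.remove) auto
    also have "(\<Prod>j\<in>?J. X (Suc j) \<omega>) = (\<Prod>j\<in>?J. exp (- (Z j \<omega> * C j)))"
      by (intro prod.cong) (auto simp: XS mult.commute)
    also have "\<dots> = exp (\<Sum>j\<in>?J. - (Z j \<omega> * C j))"
      by (rule exp_sum[symmetric]) simp
    also have "\<dots> = exp (- others_output N C m \<omega>)"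
      by (simp only: others_output_def sum_negf)
    finally show ?thesis by (simp add: XS)
  qed
  show "integrable M (\<lambda>\<omega>. Z m \<omega> * exp (- others_output N C m \<omega>))"
    using indep_vars_integrable[OF _ ind int] by (simp add: prod_eq)
  have "expectation (\<lambda>\<omega>. Z m \<omega> * exp (- others_output N C m \<omega>)) = (\<Prod>k\<in>Suc ` {..<N}. expectation (X k))"
    using indep_vars_lebesgue_integral[OF _ ind int] by (simp add: prod_eq)
  also have "\<dots> = (\<Prod>j<N. expectation (X (Suc j)))" by (simp add: prod.reindex)
  also have "\<dots> = expectation (X (Suc m)) * (\<Prod>j\<in>?J. expectation (X (Suc j)))"
    using assms(3) by (intro prod.remove) auto
  also have "\<dots> \<le> \<mu> * (\<Prod>j\<in>?J. exp (- (\<mu> / (1 + L)) * C j))"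
  proof (intro mult_mono prod_mono)
    show "expectation (X (Suc m)) \<le> \<mu>" by (simp add: XS[abs_def] Z_mean)
    fix j assume j: "j \<in> ?J"
    show "0 \<le> expectation (X (Suc j)) \<and> expectation (X (Suc j)) \<le> exp (- (\<mu> / (1 + L)) * C j)"
      using j assms expectation_exp_minus_output_le[of "C j" L j] by (auto simp: XS[abs_def])
  qed (use mean_pos in \<open>auto intro!: prod_nonneg simp: XS[abs_def]\<close>)
  also have "(\<Prod>j\<in>?J. exp (- (\<mu> / (1 + L)) * C j)) = exp (- (\<mu> / (1 + L)) * (\<Sum>j\<in>?J. C j))"
    by (simp add: exp_sum[symmetric] sum_distrib_left)
  finally show "expectation (\<lambda>\<omega>. Z m \<omega> * exp (- others_output N C m \<omega>))
      \<le> \<mu> * exp (- (\<mu> / (1 + L)) * (\<Sum>j\<in>?J. C j))" .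
qed

text \<open>
  The characteristic function of a sum of independent variables is the product of theirs. The factor
  of the demand is only known to be at most 1, as the demand may be constant; all the decay comes
  from the outputs.
\<close>

lemma cmod_char_residual_demand_le:
  assumes small: "\<And>j. j \<in> {..<N} - {m} \<Longrightarrow> \<bar>t * C j\<bar> \<le> 1"
  shows "cmod (char (distr M borel (\<lambda>\<omega>. D \<omega> - others_output N C m \<omega>)) t)
    \<le> exp (- (v / 3 * (\<Sum>j\<in>{..<N} - {m}. (C j)\<^sup>2)) * t\<^sup>2)"
proof -
  let ?J = "{..<N} - {m}"
  define Y where "Y k x = (if k = 0 then x else - (C (k - 1)) * x)" for k and x :: real
  define X where "X k \<omega> = Y k (case_nat D Z k \<omega>)" for k \<omega>
  have [measurable]: "Y k \<in> borel_measurable borel" for k unfolding Y_def by measurable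
  have X: "X 0 = D" "X (Suc j) = (\<lambda>\<omega>. - C j * Z j \<omega>)" for j
    by (auto simp: X_def[abs_def] Y_def)
  let ?I = "insert 0 (Suc ` ?J)"
  have ind: "indep_vars (\<lambda>_. borel) X ?I"
    unfolding X_def by (rule indep_vars_compose2[OF indep_vars_subset[OF indep]]) auto
  have "(\<Sum>k\<in>?I. X k \<omega>) = D \<omega> - others_output N C m \<omega>" for \<omega>
    by (simp add: X sum.reindex others_output_def sum_negf mult.commute)
  then have "char (distr M borel (\<lambda>\<omega>. D \<omega> - others_output N C m \<omega>)) t
      = (\<Prod>k\<in>?I. char (distr M borel (X k)) t)"
    using char_distr_sum[OF ind, of t] by simp
  also have "\<dots> = char (distr M borel D) t * (\<Prod>j\<in>?J. char (distr M borel (X (Suc j))) t)"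
    by (simp add: prod.reindex X)
  finally have eq: "cmod (char (distr M borel (\<lambda>\<omega>. D \<omega> - others_output N C m \<omega>)) t)
      = cmod (char (distr M borel D) t) * (\<Prod>j\<in>?J. cmod (char (distr M borel (X (Suc j))) t))"
    by (simp add: norm_mult prod_norm)
  interpret PD: real_distribution "distr M borel D"
    by (rule real_distribution_distr) simp
  have "cmod (char (distr M borel (\<lambda>\<omega>. D \<omega> - others_output N C m \<omega>)) t)
      \<le> 1 * (\<Prod>j\<in>?J. exp (- (v / 3 * (C j)\<^sup>2) * t\<^sup>2))"
    unfolding eq
  proof (intro mult_mono prod_mono conjI PD.cmod_char_le_1)
    fix j assume j: "j \<in> ?J"
    have "char (distr M borel (X (Suc j))) t = char (distr M borel (Z j)) (- (t * C j))"
      by (simp add: X char_def integral_distr mult_ac)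
    also have "cmod \<dots> \<le> exp (- variance (Z j) * (- (t * C j))\<^sup>2 / 3)"
      using small[OF j] by (intro cmod_char_le_near_zero Z_unit) auto
    finally show "cmod (char (distr M borel (X (Suc j))) t) \<le> exp (- (v / 3 * (C j)\<^sup>2) * t\<^sup>2)"
      by (simp add: Z_variance power_mult_distrib mult_ac)
  qed (auto intro!: prod_nonneg)
  also have "1 * (\<Prod>j\<in>?J. exp (- (v / 3 * (C j)\<^sup>2) * t\<^sup>2)) = exp (- (v / 3 * (\<Sum>j\<in>?J. (C j)\<^sup>2)) * t\<^sup>2)"
    by (simp add: exp_sum[symmetric] sum_distrib_left sum_distrib_right sum_negf)
  finally show ?thesis .
qed

lemma residual_demand_concentration:
  assumes "0 < b" "\<And>j. j \<in> {..<N} - {m} \<Longrightarrow> \<bar>C j\<bar> \<le> b" "0 < (\<Sum>j\<in>{..<N} - {m}. (C j)\<^sup>2)"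
  shows "\<P>(\<omega> in M. \<bar>D \<omega> - others_output N C m \<omega>\<bar> \<le> 2 * b)
    \<le> 24 * b / sqrt (v / 3 * (\<Sum>j\<in>{..<N} - {m}. (C j)\<^sup>2))"
proof -
  let ?a = "v / 3 * (\<Sum>j\<in>{..<N} - {m}. (C j)\<^sup>2)"
  have "\<P>(\<omega> in M. \<bar>D \<omega> - others_output N C m \<omega>\<bar> \<le> 1 / (1 / (2 * b))) \<le> 12 / (1 / (2 * b) * sqrt ?a)"
  proof (rule concentration_le_char_decay)
    fix t assume t: "\<bar>t\<bar> \<le> 1 / (2 * b)"
    show "cmod (char (distr M borel (\<lambda>\<omega>. D \<omega> - others_output N C m \<omega>)) t) \<le> exp (- ?a * t\<^sup>2)"
    proof (rule cmod_char_residual_demand_le)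
      fix j assume "j \<in> {..<N} - {m}"
      then have "\<bar>t * C j\<bar> \<le> 1 / (2 * b) * b"
        unfolding abs_mult using assms t by (intro mult_mono) auto
      then show "\<bar>t * C j\<bar> \<le> 1" using assms(1) by simp
    qed
  qed (use assms variance_pos in auto)
  then show ?thesis by (simp add: field_simps)
qed

section \<open>Total capacity in equilibrium\<close>

lemma nash_nonneg: "nash_equilibrium M D Z \<gamma> N C \<Longrightarrow> j < N \<Longrightarrow> 0 \<le> C j"
  by (simp add: nash_equilibrium_def)

lemma nash_deviation:
  assumes "nash_equilibrium M D Z \<gamma> N C" "i < N" "0 \<le> x"
  shows "payment M D Z N (C(i := x)) i - \<gamma> * x \<le> payment M D Z N C i - \<gamma> * C i"
  using assms unfolding nash_equilibrium_def profit_def by (metis fun_upd_same)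

text \<open>
  Leaving the market is always possible.
\<close>

lemma nash_payment_ge_cost:
  assumes nash: "nash_equilibrium M D Z \<gamma> N C" and "i < N"
  shows "\<gamma> * C i \<le> payment M D Z N C i"
proof -
  have "0 \<le> payment M D Z N (C(i := 0)) i"
    using assms nash_nonneg[OF nash] by (intro payment_bounds) auto
  then show ?thesis using nash_deviation[OF assms, of 0] by simp
qed

lemma nash_capacity_le:
  assumes nash: "nash_equilibrium M D Z \<gamma> N C" and "i < N"
  shows "C i \<le> Dmax / \<gamma>"
proof (cases "\<exists>j<N. C j \<noteq> 0")
  case True
  have Ci: "0 \<le> C i" using nash_nonneg[OF nash] assms(2) by simp
  have "\<gamma> * C i \<le> price_level N C * sales i (C i)"
    using nash_payment_ge_cost[OF assms] payment_eq[OF nash_nonneg[OF nash] True] by simp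
  also have "\<dots> \<le> 1 * Dmax"
    using price_level_bounds[of N C] nash_nonneg[OF nash] assms(2) sales_le_Dmax[OF Ci] sales_nonneg[OF Ci]
    by (intro mult_mono) auto
  finally show ?thesis using cost_pos by (simp add: field_simps)
qed (use assms cost_pos Dmin_pos Dmin_le_Dmax in auto)

text \<open>
  As long as the total capacity is below \<open>Dmin\<close>, everything that is produced can be sold, and each
  unit of capacity brings \<open>\<mu>\<close> at the cost \<open>\<gamma>\<close>. So the largest producer would expand.
\<close>

lemma nash_total_capacity_ge:
  assumes nash: "nash_equilibrium M D Z \<gamma> N C" and "0 < N" and "\<gamma> < \<mu>"
  shows "Dmin \<le> (\<Sum>i<N. C i)"
proof (rule ccontr)
  assume less: "\<not> Dmin \<le> (\<Sum>i<N. C i)"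
  define m where "m = largest_producer N C"
  have m: "m < N" "\<And>j. j < N \<Longrightarrow> C j \<le> C m"
    using largest_producer[OF \<open>0 < N\<close>] by (auto simp: m_def)
  have nonneg: "\<And>j. j < N \<Longrightarrow> 0 \<le> C j" using nash_nonneg[OF nash] .
  define T where "T = (\<Sum>j\<in>{..<N} - {m}. C j)"
  have "(\<Sum>i<N. C i) = C m + T" unfolding T_def using m by (intro sum.remove) auto
  then have x: "C m < Dmin - T" using less by simp
  then have x0: "0 < Dmin - T" using nonneg[OF m(1)] by simp
  have "residual_sales N C m (Dmin - T) = expectation (\<lambda>\<omega>. Z m \<omega> * (Dmin - T))"
    unfolding residual_sales_def
  proof (rule integral_cong_AE, measurable, rule eventually_mono[OF AE_typical])
    fix \<omega> assume \<omega>: "typical \<omega>"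
    have "others_output N C m \<omega> \<le> (\<Sum>j\<in>{..<N} - {m}. 1 * C j)"
      unfolding others_output_def using \<omega> nonneg by (intro sum_mono mult_right_mono) (auto simp: typical_def)
    moreover have "Z m \<omega> * (Dmin - T) \<le> 1 * (Dmin - T)"
      using \<omega> x0 by (intro mult_right_mono) (auto simp: typical_def)
    ultimately show "min (max (D \<omega> - others_output N C m \<omega>) 0) (Z m \<omega> * (Dmin - T)) = Z m \<omega> * (Dmin - T)"
      using \<omega> by (auto simp: typical_def T_def)
  qed
  also have "\<dots> = \<mu> * (Dmin - T)" by (simp add: Z_mean)
  finally have "payment M D Z N (C(m := Dmin - T)) m = \<mu> * (Dmin - T)"
    using payment_become_largest[of N C m "Dmin - T"] nonneg m x x0 by force
  then have "\<mu> * (Dmin - T) - \<gamma> * (Dmin - T) \<le> \<mu> * C m - \<gamma> * C m"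
    using nash_deviation[OF nash m(1), of "Dmin - T"] payment_bounds(2)[of N C m] nonneg m x0 by force
  then have "(\<mu> - \<gamma>) * (Dmin - T) \<le> (\<mu> - \<gamma>) * C m" by (simp add: algebra_simps)
  then show False using x \<open>\<gamma> < \<mu>\<close> by simp
qed

text \<open>
  The first summand bounds the capacity of the largest producer, the second one that of all the
  others.
\<close>

definition capacity_bound :: real where
  "capacity_bound = Dmax / \<gamma> + (1 + Dmax / \<gamma>) * exp Dmax / \<gamma>"

lemma capacity_bound_pos: "0 < capacity_bound"
  using Dmin_pos Dmin_le_Dmax cost_pos unfolding capacity_bound_def
  by (intro add_pos_nonneg) auto

text \<open>
  The largest producer sells at most its output, and only if the others leave some demand. So
  its sales are at most its output discounted by \<open>exp (Dmax - S)\<close>, where \<open>S\<close> is the output of the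
  others. Their expectation decays exponentially in the total capacity of the others, but has to
  cover the cost.
\<close>

lemma nash_total_capacity_le:
  assumes nash: "nash_equilibrium M D Z \<gamma> N C"
  shows "(\<Sum>i<N. C i) \<le> capacity_bound"
proof (cases "\<exists>j<N. C j \<noteq> 0")
  case True
  define L where "L = Dmax / \<gamma>"
  have L: "0 < L" using Dmin_pos Dmin_le_Dmax cost_pos by (simp add: L_def)
  define m where "m = largest_producer N C"
  have "0 < N" using True by auto
  then have m: "m < N" "\<And>j. j < N \<Longrightarrow> C j \<le> C m"
    using largest_producer by (auto simp: m_def)
  have nonneg: "\<And>j. j < N \<Longrightarrow> 0 \<le> C j" using nash_nonneg[OF nash] .
  have CL: "\<And>j. j < N \<Longrightarrow> C j \<le> L" unfolding L_def by (rule nash_capacity_le[OF nash])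
  have Cm: "0 < C m" using True m nonneg by (metis order_le_less order_less_le_trans)
  define T where "T = (\<Sum>j\<in>{..<N} - {m}. C j)"
  note disc = expectation_output_discounted_le[OF nonneg CL m(1)]
  have "\<gamma> * C m \<le> residual_sales N C m (C m)"
    using nash_payment_ge_cost[OF nash m(1)] payment_largest[OF nonneg True] by (simp add: m_def)
  also have "\<dots> \<le> expectation (\<lambda>\<omega>. (exp Dmax * C m) * (Z m \<omega> * exp (- others_output N C m \<omega>)))"
    unfolding residual_sales_def
  proof (rule integral_mono_AE)
    show "AE \<omega> in M. min (max (D \<omega> - others_output N C m \<omega>) 0) (Z m \<omega> * C m)
        \<le> (exp Dmax * C m) * (Z m \<omega> * exp (- others_output N C m \<omega>))"
    proof (rule eventually_mono[OF AE_typical])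
      fix \<omega> assume \<omega>: "typical \<omega>"
      let ?S = "others_output N C m \<omega>"
      have y: "0 \<le> Z m \<omega> * C m" using \<omega> Cm by (simp add: typical_def)
      show "min (max (D \<omega> - ?S) 0) (Z m \<omega> * C m) \<le> (exp Dmax * C m) * (Z m \<omega> * exp (- ?S))"
      proof (cases "D \<omega> \<le> ?S")
        case True
        then show ?thesis using \<omega> Cm by (auto simp: typical_def)
      next
        case False
        then have "1 \<le> exp (Dmax - ?S)" using \<omega> by (simp add: typical_def)
        then have "1 * (Z m \<omega> * C m) \<le> exp (Dmax - ?S) * (Z m \<omega> * C m)"
          using y by (rule mult_right_mono)
        moreover have "exp (Dmax - ?S) = exp Dmax * exp (- ?S)" by (simp flip: exp_add)
        ultimately have "Z m \<omega> * C m \<le> (exp Dmax * C m) * (Z m \<omega> * exp (- ?S))"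
          by (simp only: mult_ac mult_1_left)
        then show ?thesis by (rule min.coboundedI2)
      qed
    qed
  qed (use Cm disc in \<open>auto intro!: integrable_residual integrable_mult_right\<close>)
  also have "\<dots> = (exp Dmax * C m) * expectation (\<lambda>\<omega>. Z m \<omega> * exp (- others_output N C m \<omega>))"
    by simp
  also have "\<dots> \<le> (exp Dmax * C m) * (\<mu> * exp (- (\<mu> / (1 + L)) * T))"
    unfolding T_def using Cm disc(2) by (intro mult_left_mono) auto
  finally have "C m * \<gamma> \<le> C m * (exp Dmax * \<mu> * exp (- (\<mu> / (1 + L)) * T))"
    by (simp add: mult_ac)
  then have "\<gamma> \<le> exp Dmax * \<mu> * exp (- (\<mu> / (1 + L)) * T)"
    using Cm by simp
  then have "\<gamma> * exp (\<mu> / (1 + L) * T) \<le> exp Dmax * \<mu>"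
    by (simp add: exp_minus field_simps)
  moreover have "\<gamma> * (\<mu> / (1 + L) * T) \<le> \<gamma> * exp (\<mu> / (1 + L) * T)"
  proof (rule mult_left_mono)
    show "\<mu> / (1 + L) * T \<le> exp (\<mu> / (1 + L) * T)"
      using exp_ge_add_one_self[of "\<mu> / (1 + L) * T"] by linarith
  qed (use cost_pos in simp)
  ultimately have "\<gamma> * (\<mu> / (1 + L) * T) \<le> exp Dmax * \<mu>" by linarith
  then have "\<mu> * (\<gamma> * T) \<le> \<mu> * ((1 + L) * exp Dmax)"
    using L by (simp add: pos_divide_le_eq mult_ac)
  then have "T \<le> (1 + L) * exp Dmax / \<gamma>"
    using cost_pos mean_pos by (simp add: pos_le_divide_eq mult_ac)
  moreover have "(\<Sum>i<N. C i) = C m + T" unfolding T_def using m by (intro sum.remove) auto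
  ultimately show ?thesis using CL[OF m(1)] by (simp add: capacity_bound_def L_def)
qed (use capacity_bound_pos in auto)

section \<open>Bounding the margin by deviations\<close>

lemma total_profit_le_margin:
  assumes "\<And>j. j < N \<Longrightarrow> 0 \<le> C j" "\<exists>j<N. C j \<noteq> 0"
  shows "(\<Sum>i<N. payment M D Z N C i) - \<gamma> * (\<Sum>i<N. C i) \<le> (\<mu> * price_level N C - \<gamma>) * (\<Sum>i<N. C i)"
proof -
  have "0 < N" using assms(2) by auto
  have "(\<Sum>i<N. payment M D Z N C i) \<le> (\<Sum>i<N. \<mu> * price_level N C * C i)"
  proof (rule sum_mono)
    fix i assume "i \<in> {..<N}"
    then have "price_level N C * sales i (C i) \<le> price_level N C * (\<mu> * C i)"
      using price_level_bounds[OF assms(1) \<open>0 < N\<close>] assms(1) by (intro mult_left_mono sales_le) auto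
    then show "payment M D Z N C i \<le> \<mu> * price_level N C * C i"
      by (simp add: payment_eq[OF assms] mult_ac)
  qed
  then show ?thesis by (simp add: sum_distrib_left[symmetric] left_diff_distrib)
qed

text \<open>
  Producer \<open>i\<close> compares its profit, at most \<open>\<mu> * C i\<close>, with that at capacity \<open>x\<close>. Below \<open>C m\<close> the
  largest producer stays the same and its sales drop by at most \<open>x\<close>, so the price level drops by at
  most \<open>x / sales m (C m)\<close>. Both terms are small if \<open>C i\<close> is much smaller than \<open>x\<close> and \<open>x\<close>
  much smaller than \<open>C m\<close>.
\<close>

lemma margin_le_small_producer_deviation:
  assumes nash: "nash_equilibrium M D Z \<gamma> N C"
    and m: "m = largest_producer N C" and i: "i < N" "i \<noteq> m"
    and x: "0 < x" "x < C m" "x \<le> Dmin"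
  shows "\<mu> * price_level N C - \<gamma> \<le> \<mu> * C i / x + \<mu> * x / sales m (C m)"
proof -
  have nonneg: "\<And>j. j < N \<Longrightarrow> 0 \<le> C j" using nash_nonneg[OF nash] .
  let ?C = "C(i := x)" and ?s = "sales m (C m)"
  have s: "0 < ?s" using x by (intro sales_pos) auto
  have others: "others_output N ?C m \<omega> = others_output N C m \<omega> + Z i \<omega> * (x - C i)" for \<omega>
  proof -
    have "i \<in> {..<N} - {m}" using i by auto
    then show ?thesis
      unfolding others_output_def by (simp add: sum.remove algebra_simps)
  qed
  have m': "largest_producer N ?C = m"
    using largest_producer_fun_upd_less[OF i(1), of x C] x i m by auto
  have "residual_sales N C m (C m) - x
      = expectation (\<lambda>\<omega>. min (max (D \<omega> - others_output N C m \<omega>) 0) (Z m \<omega> * C m) - x)"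
    unfolding residual_sales_def using x by (simp add: integrable_residual prob_space)
  also have "\<dots> \<le> residual_sales N ?C m (C m)"
    unfolding residual_sales_def
  proof (rule integral_mono_AE)
    show "AE \<omega> in M. min (max (D \<omega> - others_output N C m \<omega>) 0) (Z m \<omega> * C m) - x
        \<le> min (max (D \<omega> - others_output N ?C m \<omega>) 0) (Z m \<omega> * C m)"
    proof (rule eventually_mono[OF AE_typical])
      fix \<omega> assume \<omega>: "typical \<omega>"
      have "Z i \<omega> * (x - C i) \<le> Z i \<omega> * x"
        using \<omega> nonneg[OF i(1)] by (intro mult_left_mono) (auto simp: typical_def)
      also have "\<dots> \<le> 1 * x" using \<omega> x by (intro mult_right_mono) (auto simp: typical_def)
      finally have "others_output N ?C m \<omega> \<le> others_output N C m \<omega> + x"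
        by (simp add: others)
      moreover have "0 \<le> Z m \<omega> * C m" using \<omega> x by (simp add: typical_def)
      ultimately show "min (max (D \<omega> - others_output N C m \<omega>) 0) (Z m \<omega> * C m) - x
        \<le> min (max (D \<omega> - others_output N ?C m \<omega>) 0) (Z m \<omega> * C m)"
        using x by linarith
    qed
  qed (use x in \<open>auto intro!: integrable_residual\<close>)
  finally have "price_level N C - x / ?s \<le> price_level N ?C"
    using s i m' m by (simp add: price_level_def Let_def diff_divide_distrib[symmetric] divide_right_mono)
  then have "(price_level N C - x / ?s) * (\<mu> * x) \<le> price_level N ?C * (\<mu> * x)"
    using mean_pos x by (intro mult_right_mono) auto
  also have "\<dots> = payment M D Z N ?C i"
  proof -
    have "\<exists>j<N. ?C j \<noteq> 0" using x i by (auto intro!: exI[of _ i])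
    moreover have "0 \<le> ?C j" if "j < N" for j using nonneg[OF that] x by simp
    ultimately have "payment M D Z N ?C i = price_level N ?C * sales i (?C i)"
      by (intro payment_eq)
    then show ?thesis using x by (simp add: sales_eq_mean)
  qed
  finally have "(price_level N C - x / ?s) * (\<mu> * x) - \<gamma> * x \<le> payment M D Z N C i - \<gamma> * C i"
    using nash_deviation[OF nash i(1), of x] x by simp
  also have "\<dots> \<le> \<mu> * C i"
    using payment_bounds(2)[of N C i, OF nonneg i(1)] cost_pos nonneg[OF i(1)] mult_nonneg_nonneg[of \<gamma> "C i"]
    by linarith
  finally have "((price_level N C - x / ?s) * \<mu> - \<gamma>) * x \<le> \<mu> * C i" by (simp add: algebra_simps)
  then have "(price_level N C - x / ?s) * \<mu> - \<gamma> \<le> \<mu> * C i / x"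
    using x by (simp add: pos_le_divide_eq)
  then show ?thesis by (simp add: algebra_simps)
qed

text \<open>
  If the largest producer doubled its capacity, it would still face the same residual demand. By
  \<open>double_min_le\<close> its sales would double, up to an error of \<open>C m\<close> on the event that this demand is
  within \<open>2 * C m\<close> of 0. Since this does not pay, the payment exceeds the cost by at most that error.
\<close>

lemma margin_le_concentration:
  assumes nash: "nash_equilibrium M D Z \<gamma> N C" and ex: "\<exists>j<N. C j \<noteq> 0"
    and m: "m = largest_producer N C" and small: "C m \<le> Dmin"
  shows "\<mu> * price_level N C - \<gamma> \<le> \<P>(\<omega> in M. \<bar>D \<omega> - others_output N C m \<omega>\<bar> \<le> 2 * C m)"
    (is "_ \<le> ?Q")
proof -
  have nonneg: "\<And>j. j < N \<Longrightarrow> 0 \<le> C j" using nash_nonneg[OF nash] .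
  have "0 < N" using ex by auto
  then have mN: "m < N" "\<And>j. j < N \<Longrightarrow> C j \<le> C m" using largest_producer by (auto simp: m)
  have Cm: "0 < C m" using ex mN nonneg by (metis order_le_less order_less_le_trans)
  let ?E = "{\<omega>\<in>space M. \<bar>D \<omega> - others_output N C m \<omega>\<bar> \<le> 2 * C m}"
  let ?r = "residual_sales N C m"
  have "payment M D Z N (C(m := 2 * C m)) m = ?r (2 * C m)"
    using Cm mN nonneg by (intro payment_become_largest) force+
  then have dev: "?r (2 * C m) - \<gamma> * (2 * C m) \<le> ?r (C m) - \<gamma> * C m"
    using nash_deviation[OF nash mN(1), of "2 * C m"] Cm payment_largest[OF nonneg ex m] by simp
  have "2 * ?r (C m) = expectation (\<lambda>\<omega>. 2 * min (max (D \<omega> - others_output N C m \<omega>) 0) (Z m \<omega> * C m))"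
    by (simp add: residual_sales_def)
  also have "\<dots> \<le> expectation (\<lambda>\<omega>. min (max (D \<omega> - others_output N C m \<omega>) 0) (Z m \<omega> * (2 * C m))
      + C m * indicator ?E \<omega>)"
  proof (rule integral_mono_AE)
    show "AE \<omega> in M. 2 * min (max (D \<omega> - others_output N C m \<omega>) 0) (Z m \<omega> * C m)
       \<le> min (max (D \<omega> - others_output N C m \<omega>) 0) (Z m \<omega> * (2 * C m)) + C m * indicator ?E \<omega>"
      using AE_typical AE_space
    proof eventually_elim
      case (elim \<omega>)
      define y where "y = Z m \<omega> * C m"
      have y: "0 \<le> y" "y \<le> 1 * C m"
        unfolding y_def using elim Cm by (auto simp: typical_def intro!: mult_right_mono)
      have y2: "Z m \<omega> * (2 * C m) = 2 * y" by (simp add: y_def)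
      show ?case
        unfolding y2 y_def[symmetric]
        using double_min_le[of y "C m" "D \<omega> - others_output N C m \<omega>"] y elim
        by (auto simp: indicator_def)
    qed
  qed (use Cm in \<open>auto intro!: integrable_residual integrable_mult_right Bochner_Integration.integrable_add simp: emeasure_eq_measure\<close>)
  also have "\<dots> = ?r (2 * C m) + C m * ?Q"
    unfolding residual_sales_def using Cm
    by (subst Bochner_Integration.integral_add)
       (auto intro!: integrable_residual integrable_mult_right simp: emeasure_eq_measure)
  finally have "?r (C m) \<le> (\<gamma> + ?Q) * C m"
    using dev by (simp add: algebra_simps)
  moreover have "\<mu> * price_level N C = ?r (C m) / C m"
    using Cm small mean_pos by (simp add: price_level_def Let_def m[symmetric] sales_eq_mean)
  moreover have "?r (C m) / C m \<le> \<gamma> + ?Q"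
    using calculation(1) Cm by (simp add: pos_divide_le_eq)
  ultimately show ?thesis by linarith
qed

text \<open>
  The first two summands serve the deviation of a small producer, the third one the deviation of the
  largest producer.
\<close>

definition margin_constant :: real where
  "margin_constant = 2 * capacity_bound * \<mu> + (Dmin + Dmax / \<gamma>) / Dmin + 48 / (sqrt (v / 3) * Dmin)"

text \<open>
  Here \<open>s\<close> is \<open>N powr - (1/6)\<close>, so the threshold between the two deviations is \<open>C m = s ^ 4\<close>. Above it
  the bound is of order \<open>1 / sqrt (N * C m) \<le> s\<close>, below it of order \<open>C m * sqrt N \<le> s\<close>; the threshold
  balances the two. The last two hypotheses hold for large \<open>N\<close> and make sure that the capacities in
  question are at most \<open>Dmin\<close>, where \<open>sales i x = \<mu> * x\<close>.
\<close>

lemma nash_margin_le: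
  assumes nash: "nash_equilibrium M D Z \<gamma> N C" and "\<gamma> < \<mu>" and "2 \<le> N"
    and s: "0 < s" "real N * s ^ 6 = 1" "2 * s ^ 4 \<le> Dmin" "s ^ 6 * (Dmax / \<gamma>) \<le> Dmin\<^sup>2"
  shows "\<mu> * price_level N C - \<gamma> \<le> margin_constant * s"
proof -
  define L where "L = Dmax / \<gamma>"
  have L: "0 < L" using Dmin_pos Dmin_le_Dmax cost_pos by (simp add: L_def)
  define m where "m = largest_producer N C"
  have "0 < N" using \<open>2 \<le> N\<close> by simp
  then have m: "m < N" "\<And>j. j < N \<Longrightarrow> C j \<le> C m"
    using largest_producer by (auto simp: m_def)
  have nonneg: "\<And>j. j < N \<Longrightarrow> 0 \<le> C j" using nash_nonneg[OF nash] .
  have total: "Dmin \<le> (\<Sum>i<N. C i)" "(\<Sum>i<N. C i) \<le> capacity_bound"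
    using nash_total_capacity_ge[OF nash \<open>0 < N\<close> \<open>\<gamma> < \<mu>\<close>] nash_total_capacity_le[OF nash] by auto
  have ex: "\<exists>j<N. C j \<noteq> 0"
  proof (rule ccontr)
    assume "\<not> ?thesis"
    then have "(\<Sum>i<N. C i) = 0" by simp
    then show False using total Dmin_pos by simp
  qed
  then have Cm: "0 < C m" using m nonneg by (metis order_le_less order_less_le_trans)
  have CmL: "C m \<le> L" using nash_capacity_le[OF nash m(1)] by (simp add: L_def)
  have split: "(\<Sum>i<N. C i) = C m + (\<Sum>j\<in>{..<N} - {m}. C j)"
    using m by (intro sum.remove) auto
  have N: "real N = 1 / s ^ 6" using s by (simp add: field_simps)
  have const_nonneg: "0 \<le> 2 * capacity_bound * \<mu>" "0 \<le> (Dmin + L) / Dmin" "0 \<le> 48 / (sqrt (v / 3) * Dmin)"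
    using capacity_bound_pos mean_pos Dmin_pos L variance_pos by auto
  show ?thesis
  proof (cases "s ^ 4 \<le> C m")
    case True
    define r where "r = sqrt (C m)"
    have r: "0 < r" "r * r = C m" using Cm by (auto simp: r_def)
    have "(s\<^sup>2)\<^sup>2 = s ^ 4" by (simp add: eval_nat_numeral mult.assoc)
    then have "(s\<^sup>2)\<^sup>2 \<le> r\<^sup>2" using True r(2) by (simp add: power2_eq_square[of r])
    then have rs: "s\<^sup>2 \<le> r" by (rule power2_le_imp_le) (use r in simp)
    \<comment> \<open>this is \<open>sqrt (C m / N)\<close>, which balances the two terms of the deviation bound\<close>
    define x where "x = r * s ^ 3"
    have x0: "0 < x" using r s by (simp add: x_def)
    have "1 < real N" using \<open>2 \<le> N\<close> by simp
    then have "s ^ 6 < 1" using s by (simp add: N)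
    then have s1: "s < 1" using one_le_power[of s 6] by linarith
    have "s * s\<^sup>2 < 1 * r" using s s1 rs r by (intro mult_less_le_imp_less) auto
    then have "r * (s * s\<^sup>2) < r * (1 * r)" using r by (intro mult_strict_left_mono) auto
    then have xC: "x < C m" using r by (simp add: x_def power3_eq_cube power2_eq_square)
    have "x\<^sup>2 = s ^ 6 * C m"
    proof -
      have "x\<^sup>2 = (r * r) * s ^ 6" by (simp add: x_def eval_nat_numeral)
      then show ?thesis using r by simp
    qed
    also have "\<dots> \<le> s ^ 6 * L" using CmL s by (intro mult_left_mono) auto
    also have "\<dots> \<le> Dmin\<^sup>2" using s by (simp add: L_def)
    finally have xD: "x \<le> Dmin" by (rule power2_le_imp_le) (use Dmin_pos in simp)
    \<comment> \<open>the \<open>N - 1 \<ge> N / 2\<close> others cannot all have more than twice the average of the bound\<close>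
    obtain i where i: "i < N" "i \<noteq> m" "C i \<le> 2 * capacity_bound * s ^ 6"
    proof (rule ccontr)
      assume "\<not> thesis"
      then have "\<And>j. j \<in> {..<N} - {m} \<Longrightarrow> 2 * capacity_bound * s ^ 6 < C j" using that by force
      then have "(\<Sum>j\<in>{..<N} - {m}. 2 * capacity_bound * s ^ 6) \<le> (\<Sum>j\<in>{..<N} - {m}. C j)"
        by (intro sum_mono) (auto intro: less_imp_le)
      also have "\<dots> < capacity_bound" using split total Cm by linarith
      finally have "(real N - 1) * (2 * capacity_bound * s ^ 6) < capacity_bound"
        using m \<open>0 < N\<close> by (simp add: of_nat_diff)
      moreover have "real N / 2 * (2 * capacity_bound * s ^ 6) \<le> (real N - 1) * (2 * capacity_bound * s ^ 6)"
        using \<open>2 \<le> N\<close> s capacity_bound_pos by (intro mult_right_mono) auto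
      moreover have "real N / 2 * (2 * capacity_bound * s ^ 6) = capacity_bound"
        using s by (simp add: N)
      ultimately show False by linarith
    qed
    have "\<mu> * C i / x \<le> \<mu> * (2 * capacity_bound * s ^ 6) / (s\<^sup>2 * s ^ 3)"
      unfolding x_def using i mean_pos capacity_bound_pos s rs nonneg
      by (intro frac_le mult_left_mono mult_right_mono mult_pos_pos) auto
    also have "\<dots> = 2 * capacity_bound * \<mu> * s"
    proof -
      have "s ^ 6 = s\<^sup>2 * s ^ 3 * s" by (simp add: eval_nat_numeral)
      then show ?thesis using s by simp
    qed
    finally have 1: "\<mu> * C i / x \<le> 2 * capacity_bound * \<mu> * s" .
    have k: "Dmin / (Dmin + L) * C m \<le> min (C m) Dmin"
    proof (rule min.boundedI)
      show "Dmin / (Dmin + L) * C m \<le> C m"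
        using Dmin_pos L Cm by (intro mult_left_le_one_le) auto
      have "Dmin * C m \<le> Dmin * (Dmin + L)" using Dmin_pos CmL by (intro mult_left_mono) auto
      then show "Dmin / (Dmin + L) * C m \<le> Dmin" using Dmin_pos L by (simp add: field_simps)
    qed
    have "\<mu> * (Dmin / (Dmin + L) * C m) \<le> sales m (C m)"
      using mult_left_mono[OF k, of \<mu>] mean_pos sales_ge[of "C m" m] Cm by linarith
    then have "\<mu> * x / sales m (C m) \<le> \<mu> * x / (\<mu> * (Dmin / (Dmin + L) * C m))"
      using mean_pos x0 Dmin_pos L Cm by (intro divide_left_mono mult_pos_pos sales_pos) auto
    also have "\<dots> = (Dmin + L) / Dmin * (s ^ 3 / r)"
      using r mean_pos Dmin_pos L unfolding x_def r(2)[symmetric] by (simp add: field_simps)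
    also have "\<dots> \<le> (Dmin + L) / Dmin * (s ^ 3 / s\<^sup>2)"
      using rs s r Dmin_pos L by (intro mult_left_mono divide_left_mono) auto
    also have "s ^ 3 / s\<^sup>2 = s" using s by (simp add: power3_eq_cube power2_eq_square)
    finally have 2: "\<mu> * x / sales m (C m) \<le> (Dmin + L) / Dmin * s" .
    have "\<mu> * price_level N C - \<gamma> \<le> 2 * capacity_bound * \<mu> * s + (Dmin + L) / Dmin * s + 0 * s"
      using margin_le_small_producer_deviation[OF nash m_def i(1,2) x0 xC xD] 1 2 by linarith
    also have "\<dots> \<le> 2 * capacity_bound * \<mu> * s + (Dmin + L) / Dmin * s + 48 / (sqrt (v / 3) * Dmin) * s"
      using const_nonneg s by (intro add_left_mono mult_right_mono) auto
    finally show ?thesis by (simp add: margin_constant_def L_def distrib_right)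
  next
    case False
    let ?T = "\<Sum>j\<in>{..<N} - {m}. C j" and ?V = "\<Sum>j\<in>{..<N} - {m}. (C j)\<^sup>2"
    \<comment> \<open>the smallest possible sum of squares is attained by equal capacities\<close>
    have "Dmin / 2 \<le> ?T" using split total s False by linarith
    then have "(Dmin / 2)\<^sup>2 \<le> ?T\<^sup>2" using Dmin_pos by (intro power_mono) auto
    also have "\<dots> \<le> ?V * card ({..<N} - {m})" by (rule sum_squared_le_sum_of_squares)
    also have "\<dots> \<le> ?V * real N"
      by (intro mult_left_mono sum_nonneg) (auto intro!: order_trans[OF card_Diff1_le])
    finally have V: "(Dmin / 2)\<^sup>2 * s ^ 6 \<le> ?V" using s by (simp add: N field_simps)
    have Vpos: "0 < (Dmin / 2)\<^sup>2 * s ^ 6" using Dmin_pos s by simp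
    have "sqrt (v / 3) * (Dmin / 2 * s ^ 3) = sqrt (v / 3 * ((Dmin / 2)\<^sup>2 * s ^ 6))"
    proof -
      have "s ^ 6 = (s ^ 3)\<^sup>2" by (simp add: eval_nat_numeral mult.assoc)
      then show ?thesis using Dmin_pos s by (simp only: real_sqrt_mult real_sqrt_abs) simp
    qed
    also have "\<dots> \<le> sqrt (v / 3 * ?V)"
      using V variance_pos by (intro real_sqrt_le_mono mult_left_mono) auto
    finally have sq: "sqrt (v / 3) * (Dmin / 2 * s ^ 3) \<le> sqrt (v / 3 * ?V)" .
    have "\<mu> * price_level N C - \<gamma> \<le> \<P>(\<omega> in M. \<bar>D \<omega> - others_output N C m \<omega>\<bar> \<le> 2 * C m)"
      using False s Dmin_pos by (intro margin_le_concentration[OF nash ex m_def]) linarith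
    also have "\<dots> \<le> 24 * C m / sqrt (v / 3 * ?V)"
      using Cm m nonneg V Vpos by (intro residual_demand_concentration) (auto intro: less_le_trans)
    also have "\<dots> \<le> 24 * s ^ 4 / (sqrt (v / 3) * (Dmin / 2 * s ^ 3))"
      using sq False Cm Dmin_pos s variance_pos by (intro frac_le mult_pos_pos) auto
    also have "\<dots> = 0 * s + 48 / (sqrt (v / 3) * Dmin) * s"
    proof -
      have "s ^ 4 = s * s ^ 3" by (simp add: eval_nat_numeral)
      then show ?thesis using s Dmin_pos variance_pos by simp
    qed
    also have "\<dots> \<le> (2 * capacity_bound * \<mu> + (Dmin + L) / Dmin) * s + 48 / (sqrt (v / 3) * Dmin) * s"
      using const_nonneg s by (intro add_right_mono mult_right_mono) auto
    finally show ?thesis by (simp add: margin_constant_def L_def distrib_right)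
  qed
qed

section \<open>Total profit and efficiency\<close>

lemma nash_total_payment_le_cost:
  assumes "nash_equilibrium M D Z \<gamma> N C" "\<mu> \<le> \<gamma>"
  shows "(\<Sum>i<N. payment M D Z N C i) \<le> \<gamma> * (\<Sum>i<N. C i)"
proof -
  have "payment M D Z N C i \<le> \<gamma> * C i" if "i < N" for i
    using payment_bounds(2)[of N C i] nash_nonneg[OF assms(1)] that
      mult_right_mono[OF assms(2), of "C i"] by force
  then show ?thesis unfolding sum_distrib_left by (intro sum_mono) auto
qed

text \<open>
  For large \<open>N\<close> the margin bound applies; the finitely many remaining \<open>N\<close> are absorbed into \<open>\<alpha>\<close>,
  since the total payment never exceeds \<open>\<mu> * capacity_bound\<close>.
\<close>

lemma nash_total_profit_le:
  "\<exists>\<alpha>>0. \<forall>N C. nash_equilibrium M D Z \<gamma> N C \<longrightarrow>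
     (\<Sum>i<N. payment M D Z N C i) \<le> \<gamma> * (\<Sum>i<N. C i) + \<alpha> * real N powr - (1 / 6)"
proof (cases "\<mu> \<le> \<gamma>")
  case True
  show ?thesis
  proof (intro exI[of _ 1] conjI allI impI)
    fix N C assume "nash_equilibrium M D Z \<gamma> N C"
    then show "(\<Sum>i<N. payment M D Z N C i) \<le> \<gamma> * (\<Sum>i<N. C i) + 1 * real N powr - (1 / 6)"
      using nash_total_payment_le_cost[OF _ True] by (simp add: add_increasing2)
  qed simp
next
  case False
  define s where "s N = real N powr - (1 / 6)" for N
  have s_pos: "0 < s N" "real N * s N ^ 6 = 1" if "0 < N" for N
  proof -
    show "0 < s N" using that by (simp add: s_def)
    have "s N ^ 6 = real N powr (- 1)" using that by (simp add: s_def powr_power)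
    then show "real N * s N ^ 6 = 1" using that by (simp add: powr_minus)
  qed
  have s_lim: "s \<longlonglongrightarrow> 0"
    unfolding s_def by (rule tendsto_neg_powr[OF _ filterlim_real_sequentially]) simp
  have lim4: "(\<lambda>N. 2 * s N ^ 4) \<longlonglongrightarrow> 2 * 0 ^ 4"
    by (intro tendsto_mult tendsto_power tendsto_const s_lim)
  have lim6: "(\<lambda>N. s N ^ 6 * (Dmax / \<gamma>)) \<longlonglongrightarrow> 0 ^ 6 * (Dmax / \<gamma>)"
    by (intro tendsto_mult tendsto_power tendsto_const s_lim)
  have "\<forall>\<^sub>F N in sequentially. 2 * s N ^ 4 < Dmin"
    by (rule order_tendstoD(2)[OF lim4]) (use Dmin_pos in simp)
  moreover have "\<forall>\<^sub>F N in sequentially. s N ^ 6 * (Dmax / \<gamma>) < Dmin\<^sup>2"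
    by (rule order_tendstoD(2)[OF lim6]) (use Dmin_pos in simp)
  ultimately have "\<forall>\<^sub>F N in sequentially. 2 * s N ^ 4 \<le> Dmin \<and> s N ^ 6 * (Dmax / \<gamma>) \<le> Dmin\<^sup>2 \<and> 2 \<le> N"
    using eventually_ge_at_top[of 2] by eventually_elim auto
  then obtain N0 where N0: "\<And>N. N0 \<le> N \<Longrightarrow> 2 * s N ^ 4 \<le> Dmin \<and> s N ^ 6 * (Dmax / \<gamma>) \<le> Dmin\<^sup>2 \<and> 2 \<le> N"
    unfolding eventually_sequentially by blast
  define \<alpha> where "\<alpha> = margin_constant * capacity_bound + \<mu> * capacity_bound * real (Suc N0)"
  have mc: "0 < margin_constant"
    using capacity_bound_pos mean_pos Dmin_pos Dmin_le_Dmax cost_pos variance_pos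
    unfolding margin_constant_def by (intro add_pos_pos) (auto intro!: divide_pos_pos add_pos_pos)
  have \<alpha>: "margin_constant * capacity_bound \<le> \<alpha>" "\<mu> * capacity_bound * real (Suc N0) \<le> \<alpha>" "0 < \<alpha>"
    unfolding \<alpha>_def using mc capacity_bound_pos mean_pos by (auto intro!: add_pos_pos)
  show ?thesis
  proof (intro exI[of _ \<alpha>] conjI allI impI)
    fix N C assume nash: "nash_equilibrium M D Z \<gamma> N C"
    have nonneg: "\<And>j. j < N \<Longrightarrow> 0 \<le> C j" using nash_nonneg[OF nash] .
    have sum_nonneg: "0 \<le> (\<Sum>i<N. C i)" using nonneg by (intro sum_nonneg) auto
    have total: "(\<Sum>i<N. C i) \<le> capacity_bound" by (rule nash_total_capacity_le[OF nash])
    show "(\<Sum>i<N. payment M D Z N C i) \<le> \<gamma> * (\<Sum>i<N. C i) + \<alpha> * real N powr - (1 / 6)"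
      unfolding s_def[symmetric]
    proof (cases "N = 0")
      case True
      then show "(\<Sum>i<N. payment M D Z N C i) \<le> \<gamma> * (\<Sum>i<N. C i) + \<alpha> * s N" by (simp add: s_def)
    next
      case N: False
      show "(\<Sum>i<N. payment M D Z N C i) \<le> \<gamma> * (\<Sum>i<N. C i) + \<alpha> * s N"
      proof (cases "N0 \<le> N")
        case True
        have "Dmin \<le> (\<Sum>i<N. C i)" using nash_total_capacity_ge[OF nash] N False by simp
        then have ex: "\<exists>j<N. C j \<noteq> 0"
          using Dmin_pos by (metis lessThan_iff linorder_not_le sum.neutral)
        have "\<mu> * price_level N C - \<gamma> \<le> margin_constant * s N"
          using nash_margin_le[OF nash, of "s N"] False N0[OF True] s_pos N by auto
        then have "(\<mu> * price_level N C - \<gamma>) * (\<Sum>i<N. C i) \<le> margin_constant * s N * (\<Sum>i<N. C i)"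
          using sum_nonneg by (rule mult_right_mono)
        also have "\<dots> \<le> margin_constant * s N * capacity_bound"
          using total mc s_pos N by (intro mult_left_mono) (auto intro: less_imp_le)
        also have "\<dots> = margin_constant * capacity_bound * s N" by simp
        also have "\<dots> \<le> \<alpha> * s N"
          using \<alpha> s_pos N by (intro mult_right_mono) (auto intro: less_imp_le)
        finally show ?thesis using total_profit_le_margin[OF nonneg ex] by linarith
      next
        case small: False
        have "(\<Sum>i<N. payment M D Z N C i) \<le> (\<Sum>i<N. \<mu> * C i)"
          using payment_bounds(2)[of N C] nonneg by (intro sum_mono) auto
        also have "\<dots> \<le> \<mu> * capacity_bound"
          using total mean_pos by (simp flip: sum_distrib_left)
        also have "\<dots> = \<mu> * capacity_bound * 1" by simp
        also have "\<dots> \<le> \<mu> * capacity_bound * (real (Suc N0) * s N)"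
        proof (intro mult_left_mono)
          have "s N \<le> 1" using powr_mono[of "- (1 / 6)" 0 "real N"] N by (simp add: s_def)
          have "s N ^ 6 = s N ^ 5 * s N" by (simp add: eval_nat_numeral)
          also have "\<dots> \<le> 1 * s N"
            using \<open>s N \<le> 1\<close> s_pos N by (intro mult_right_mono power_le_one) (auto intro: less_imp_le)
          finally have "real N * s N ^ 6 \<le> real (Suc N0) * s N"
            using small s_pos N by (intro mult_mono) (auto intro: less_imp_le)
          then show "1 \<le> real (Suc N0) * s N" using s_pos N by simp
        qed (use mean_pos capacity_bound_pos in auto)
        also have "\<dots> = \<mu> * capacity_bound * real (Suc N0) * s N" by (simp only: mult.assoc)
        also have "\<dots> \<le> \<alpha> * s N"
          using \<alpha> s_pos N by (intro mult_right_mono) (auto intro: less_imp_le)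
        finally show ?thesis using mult_nonneg_nonneg[of \<gamma> "\<Sum>i<N. C i"] cost_pos sum_nonneg by linarith
      qed
    qed
  qed (use \<alpha> in simp)
qed

lemma nash_efficiency_ge:
  assumes nash: "nash_equilibrium M D Z \<gamma> N C" and ex: "\<exists>i<N. C i \<noteq> 0"
    and profit: "(\<Sum>i<N. payment M D Z N C i) \<le> \<gamma> * (\<Sum>i<N. C i) + \<delta>" and "0 \<le> \<delta>"
  shows "\<bar>market_efficiency M D Z \<gamma> N C - 1\<bar> \<le> \<delta> / (\<gamma> * Dmin)"
proof -
  let ?R = "\<Sum>i<N. payment M D Z N C i" and ?K = "\<gamma> * (\<Sum>i<N. C i)"
  have nonneg: "\<And>j. j < N \<Longrightarrow> 0 \<le> C j" using nash_nonneg[OF nash] .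
  obtain i where "i < N" "C i \<noteq> 0" using ex by auto
  then have "0 < (\<Sum>i<N. C i)" using nonneg by (intro sum_pos2[of _ i]) (auto simp: less_le)
  then have K: "0 < ?K" using cost_pos by simp
  have KR: "?K \<le> ?R" unfolding sum_distrib_left using nash_payment_ge_cost[OF nash] by (intro sum_mono) auto
  have eff: "\<bar>market_efficiency M D Z \<gamma> N C - 1\<bar> = (?R - ?K) / ?R"
    using K KR by (simp add: market_efficiency_def abs_if field_simps)
  show ?thesis
  proof (cases "\<mu> \<le> \<gamma>")
    case True
    then have "?R = ?K" using nash_total_payment_le_cost[OF nash] KR by simp
    then show ?thesis using eff \<open>0 \<le> \<delta>\<close> cost_pos Dmin_pos by simp
  next
    case False
    have "0 < N" using ex by auto
    then have "\<gamma> * Dmin \<le> ?K"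
      using nash_total_capacity_ge[OF nash] False cost_pos by simp
    then have "\<gamma> * Dmin \<le> ?R" using KR by linarith
    then show ?thesis
      unfolding eff using KR profit \<open>0 \<le> \<delta>\<close> cost_pos Dmin_pos by (intro frac_le) auto
  qed
qed

end

theorem theorem3:
  fixes M :: "'a measure"
    and D :: "'a \<Rightarrow> real" and Z :: "nat \<Rightarrow> 'a \<Rightarrow> real"
    and f :: "real \<Rightarrow> real" and Dmin Dmax \<gamma> :: real
  assumes "prob_space M"
    and "D \<in> borel_measurable M"
    and "0 < Dmin"
    and "AE \<omega> in M. Dmin \<le> D \<omega> \<and> D \<omega> \<le> Dmax"
    and "prob_space.indep_vars M (\<lambda>_. borel) (case_nat D Z) UNIV"
    and "\<And>x. 0 \<le> f x"
    and "\<And>i. distributed M lborel (Z i) (\<lambda>x. ennreal (f x))"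
    and "\<And>i. topological_support (distr M borel (Z i)) = {0..1}"
    and "bounded (f ` {0..1})"
    and "continuous_on {0..1} f"
    and "\<And>i. prob_space.variance M (Z i) > 0"
    and "0 < \<gamma>"
  shows "(\<exists>\<alpha> c. 0 < \<alpha> \<and> 0 < c \<and>
            (\<forall>N C. real N > 1 / (Dmin / Dmax * \<gamma>) \<longrightarrow> nash_equilibrium M D Z \<gamma> N C \<longrightarrow>
              (\<Sum>i<N. payment M D Z N C i) \<le> \<gamma> * (\<Sum>i<N. C i) + \<alpha> * real N powr (- c)))
       \<and> (\<forall>\<epsilon>>0. \<forall>\<^sub>F N in sequentially. \<forall>C.
            nash_equilibrium M D Z \<gamma> N C \<longrightarrow> (\<exists>i<N. C i \<noteq> 0) \<longrightarrow>
              \<bar>market_efficiency M D Z \<gamma> N C - 1\<bar> < \<epsilon>)"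
proof -
  interpret prob_space M by fact
  have [measurable]: "Z i \<in> borel_measurable M" for i
    using assms(7)[of i] by (simp add: distributed_def)
  have Z_unit: "AE \<omega> in M. 0 \<le> Z i \<omega> \<and> Z i \<omega> \<le> 1" for i
  proof -
    interpret P: prob_space "distr M borel (Z i)" by (rule prob_space_distr) measurable
    have "AE x in distr M borel (Z i). 0 \<le> x \<and> x \<le> 1"
      using assms(8)[of i] by (intro support_subset_interval_AE P.finite_measure_axioms) auto
    then show ?thesis by (subst (asm) AE_distr_iff) auto
  qed
  \<comment> \<open>equal densities give equal laws, hence equal means and variances\<close>
  have law: "distr M borel (Z i) = density lborel (\<lambda>x. ennreal (f x))" (is "_ = ?L") for i
  proof -
    have "distr M borel (Z i) = distr M lborel (Z i)" by (rule distr_cong) simp_all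
    also have "\<dots> = ?L" using assms(7)[of i] by (simp only: distributed_def)
    finally show ?thesis .
  qed
  have mean_L: "expectation (Z i) = (\<integral>x. x \<partial>?L)" for i
    unfolding law[of i, symmetric] by (simp add: integral_distr)
  have mean: "expectation (Z i) = expectation (Z 0)" for i
    unfolding mean_L ..
  have var_L: "variance (Z i) = (\<integral>x. (x - (\<integral>x. x \<partial>?L))\<^sup>2 \<partial>?L)" for i
    unfolding mean_L unfolding law[of i, symmetric] by (simp add: integral_distr)
  have var: "variance (Z i) = variance (Z 0)" for i
    unfolding var_L ..
  have Z_int: "integrable M (Z 0)"
    using Z_unit[of 0] by (intro integrable_const_bound[where B = 1]) auto
  have "0 \<le> expectation (Z 0)"
    using Z_unit[of 0] by (intro integral_nonneg_AE) auto
  \<comment> \<open>a nonnegative variable of mean 0 vanishes almost everywhere and has no variance\<close>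
  moreover have "expectation (Z 0) \<noteq> 0"
  proof
    assume 0: "expectation (Z 0) = 0"
    then have "AE \<omega> in M. Z 0 \<omega> = 0"
      using integral_nonneg_eq_0_iff_AE[OF Z_int] Z_unit[of 0] by auto
    then have "variance (Z 0) = expectation (\<lambda>_. 0)"
      unfolding 0 by (intro integral_cong_AE) auto
    then show False using assms(11)[of 0] by simp
  qed
  ultimately have "0 < expectation (Z 0)" by simp
  then interpret random_supply M D Z Dmin Dmax "expectation (Z 0)" "variance (Z 0)" \<gamma>
    by unfold_locales (rule assms Z_unit mean var | assumption)+
  obtain \<alpha> where \<alpha>: "0 < \<alpha>" and bound: "\<And>N C. nash_equilibrium M D Z \<gamma> N C \<Longrightarrow>
      (\<Sum>i<N. payment M D Z N C i) \<le> \<gamma> * (\<Sum>i<N. C i) + \<alpha> * real N powr - (1 / 6)"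
    using nash_total_profit_le by blast
  show ?thesis
  proof (intro conjI allI impI)
    show "\<exists>\<alpha> c. 0 < \<alpha> \<and> 0 < c \<and>
        (\<forall>N C. real N > 1 / (Dmin / Dmax * \<gamma>) \<longrightarrow> nash_equilibrium M D Z \<gamma> N C \<longrightarrow>
          (\<Sum>i<N. payment M D Z N C i) \<le> \<gamma> * (\<Sum>i<N. C i) + \<alpha> * real N powr (- c))"
      using \<alpha> bound by (intro exI[of _ \<alpha>] exI[of _ "1 / 6"]) auto
  next
    fix \<epsilon> :: real assume \<epsilon>: "0 < \<epsilon>"
    have "(\<lambda>N. real N powr - (1 / 6)) \<longlonglongrightarrow> 0"
      by (rule tendsto_neg_powr[OF _ filterlim_real_sequentially]) simp
    then have "(\<lambda>N. \<alpha> * real N powr - (1 / 6) / (\<gamma> * Dmin)) \<longlonglongrightarrow> \<alpha> * 0 / (\<gamma> * Dmin)"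
      by (intro tendsto_intros) (use assms in auto)
    then have "\<forall>\<^sub>F N in sequentially. \<alpha> * real N powr - (1 / 6) / (\<gamma> * Dmin) < \<epsilon>"
      by (rule order_tendstoD(2)) (use \<epsilon> in simp)
    then show "\<forall>\<^sub>F N in sequentially. \<forall>C. nash_equilibrium M D Z \<gamma> N C \<longrightarrow> (\<exists>i<N. C i \<noteq> 0) \<longrightarrow>
        \<bar>market_efficiency M D Z \<gamma> N C - 1\<bar> < \<epsilon>"
    proof (rule eventually_mono, intro allI impI)
      fix N C assume small: "\<alpha> * real N powr - (1 / 6) / (\<gamma> * Dmin) < \<epsilon>"
        and nash: "nash_equilibrium M D Z \<gamma> N C" and ex: "\<exists>i<N. C i \<noteq> 0"
      show "\<bar>market_efficiency M D Z \<gamma> N C - 1\<bar> < \<epsilon>"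
        using nash_efficiency_ge[OF nash ex bound[OF nash]] \<alpha> small by simp
    qed
  qed
qed

end
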